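(* Let $\Omega$ be an arbitrary index set. Suppose $\nu$ is a constructibly Radon measure on $\mathbb{R}^{\Omega}$ (with finite moments) and $s\in (1,\infty)$. Suppose that for each $j\in \Omega$ there exist $q_{jk} \in A_{\Omega}\otimes_{\mathbb{R}} \mathbb{C}$, $k=1,2,\dots$, such that $\| q_{jk}-\frac{1}{x_j-\mathrm{i}}\|_{s,\nu} \rightarrow 0$ as $k\rightarrow \infty$. Then $A_{\Omega}\otimes_{\mathbb{R}} \mathbb{C}$ is dense in $\mathcal{L}^{s'}(\nu)$ for each $s' \in [1,s)$.
   Context: $A_\Omega=\mathbb{R}[x_i\mid i\in\Omega]$, so $A_\Omega\otimes_{\mathbb{R}}\mathbb{C}=\mathbb{C}[x_i\mid i\in\Omega]$; $\mathrm{i}=\sqrt{-1}$. Polynomials and the function $\frac{1}{x_j-\mathrm{i}}$ are viewed as functions on $\mathbb{R}^\Omega$. For a commutative $\mathbb{R}$-algebra $D$ with $1$, $X(D)$ is the set of unital ring homomorphisms $\alpha:D\to\mathbb{R}$ with the weakest topology making all $\hat a:\alpha\mapsto\alpha(a)$, $a\in D$, continuous. A subset of $X(D)$ is constructibly Borel if it lies in the $\sigma$-algebra generated by the sets $\{\alpha\in X(D)\mid\alpha(a)>0\}$, $a\in D$. A Radon measure is a positive, locally finite, inner regular (with respect to compact sets) measure on the Borel $\sigma$-algebra. A constructibly Radon measure on $X(D)$ is a positive measure on the $\sigma$-algebra of constructibly Borel sets such that, for each countably generated subalgebra $D'$ of $D$, its pushforward to $X(D')$ via $\alpha\mapsto\alpha|_{D'}$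 is Radon. $\mathbb{R}^\Omega$ is identified with $X(A_\Omega)$ via point evaluations. By convention, a constructibly Radon measure $\nu$ on $\mathbb{R}^\Omega$ is required to have finite moments: $\int \hat f\,d\nu$ is well-defined and finite for every monomial $f$ in the $x_i$. For $s\in[1,\infty)$, $\|f\|_{s,\nu}=[\int|f|^s\,d\nu]^{1/s}$ and $\mathcal{L}^s(\nu)$ is the $\mathbb{C}$-vector space of measurable $f:\mathbb{R}^\Omega\to\mathbb{C}$ with $\|f\|_{s,\nu}<\infty$, equipped with $\|\cdot\|_{s,\nu}$. *)

theory Defs
  imports "HOL-Analysis.Analysis" "HOL-Analysis.Finite_Function_Topology"
begin

section \<open>Polynomials in arbitrarily many variables\<close>

text \<open>
  A monomial is a finitely supported exponent function, a polynomial a finitely supported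
  map from monomials to coefficients; \<open>+\<close> and \<open>*\<close> are those of \<^theory>\<open>HOL-Library.Poly_Mapping\<close>.
  The variables are indexed by a subset \<open>\<Omega>\<close> of a type, so \<open>\<Omega>\<close> may be empty.
\<close>

type_synonym ('i, 'a) mpoly = "('i \<Rightarrow>\<^sub>0 nat) \<Rightarrow>\<^sub>0 'a"

definition polys :: "'i set \<Rightarrow> ('i, 'a::zero) mpoly set" where
  "polys \<Omega> = {p. \<forall>m \<in> Poly_Mapping.keys p. Poly_Mapping.keys m \<subseteq> \<Omega>}"

definition poly_eval :: "('i \<Rightarrow> 'a) \<Rightarrow> ('i, 'a::comm_semiring_1) mpoly \<Rightarrow> 'a" where
  "poly_eval x p = (\<Sum>m \<in> Poly_Mapping.keys p. Poly_Mapping.lookup p m *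
     (\<Prod>i \<in> Poly_Mapping.keys m. x i ^ Poly_Mapping.lookup m i))"

instance poly_mapping :: (monoid_add, real_algebra_1) real_algebra_1
proof
  have lookup_scaleR: "Poly_Mapping.lookup (r *\<^sub>R p) k = r *\<^sub>R Poly_Mapping.lookup p k"
    for r k and p :: "'c \<Rightarrow>\<^sub>0 'd::real_vector"
  proof -
    have "finite {i. r *\<^sub>R Poly_Mapping.lookup p i \<noteq> 0}"
      by (rule finite_subset[of _ "{i. Poly_Mapping.lookup p i \<noteq> 0}"]) auto
    then show ?thesis by (simp add: scaleR_poly_mapping_def)
  qed
  have scaleR_left: "r *\<^sub>R p = Poly_Mapping.single 0 (r *\<^sub>R 1) * p" for r and p :: "'a \<Rightarrow>\<^sub>0 'b"
    by (rule poly_mapping_eqI)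
      (simp add: lookup_scaleR mult_map_scale_conv_mult[symmetric] Poly_Mapping.map.rep_eq when_def)
  have comm: "p * Poly_Mapping.single 0 (r *\<^sub>R 1) = Poly_Mapping.single 0 (r *\<^sub>R 1) * p"
    for r and p :: "'a \<Rightarrow>\<^sub>0 'b"
  proof (induction p rule: Poly_Mapping.update_induct)
    case const
    show ?case by simp
  next
    case (update f a b)
    have "Poly_Mapping.update a b f = f + Poly_Mapping.single a b"
      using update by (intro poly_mapping_eqI)
        (auto simp: lookup_update lookup_add lookup_single when_def in_keys_iff)
    then show ?case
      using update by (simp add: distrib_left distrib_right mult_single)
  qed
  fix a :: real and x y :: "'a \<Rightarrow>\<^sub>0 'b"
  show "a *\<^sub>R x * y = a *\<^sub>R (x * y)"
    by (simp add: scaleR_left mult.assoc)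
  show "x * a *\<^sub>R y = a *\<^sub>R (x * y)"
    by (simp add: scaleR_left mult.assoc[symmetric] comm)
qed

section \<open>The character space of a commutative real algebra\<close>

text \<open>
  Throughout, the algebra \<open>D\<close> is the carrier of a unital subalgebra of a type of commutative
  real algebras.  Characters are extensional functions on \<open>D\<close>.
\<close>

definition real_subalgebra :: "'a::{real_algebra_1, comm_ring_1} set \<Rightarrow> bool" where
  "real_subalgebra D \<longleftrightarrow> 1 \<in> D \<and>
     (\<forall>a\<in>D. \<forall>b\<in>D. a + b \<in> D \<and> a * b \<in> D) \<and> (\<forall>r. \<forall>a\<in>D. r *\<^sub>R a \<in> D)"

definition countably_generated :: "'a::{real_algebra_1, comm_ring_1} set \<Rightarrow> bool" where
  "countably_generated D \<longleftrightarrow> (\<exists>S. countable S \<and> D = real_subalgebra hull S)"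

definition characters :: "'a::{real_algebra_1, comm_ring_1} set \<Rightarrow> ('a \<Rightarrow> real) set" where
  "characters D = {\<alpha> \<in> extensional D. \<alpha> 1 = 1 \<and>
     (\<forall>a\<in>D. \<forall>b\<in>D. \<alpha> (a + b) = \<alpha> a + \<alpha> b \<and> \<alpha> (a * b) = \<alpha> a * \<alpha> b)}"

definition character_topology ::
    "'a::{real_algebra_1, comm_ring_1} set \<Rightarrow> ('a \<Rightarrow> real) topology" where
  "character_topology D =
     topology_generated_by {{\<alpha> \<in> characters D. \<alpha> a \<in> U} | a U. a \<in> D \<and> open U}"

definition constructible_borel ::
    "'a::{real_algebra_1, comm_ring_1} set \<Rightarrow> ('a \<Rightarrow> real) measure" where
  "constructible_borel D = sigma (characters D) {{\<alpha> \<in> characters D. \<alpha> a > 0} | a. a \<in> D}"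

section \<open>Radon and constructibly Radon measures\<close>

definition radon_measure :: "'b topology \<Rightarrow> 'b measure \<Rightarrow> bool" where
  "radon_measure T \<mu> \<longleftrightarrow>
     space \<mu> = topspace T \<and>
     sets \<mu> = sigma_sets (topspace T) {U. openin T U} \<and>
     (\<forall>x\<in>topspace T. \<exists>U. openin T U \<and> x \<in> U \<and> emeasure \<mu> U < \<infinity>) \<and>
     (\<forall>B\<in>sets \<mu>. emeasure \<mu> B = (SUP K\<in>{K. compactin T K \<and> K \<subseteq> B}. emeasure \<mu> K))"

text \<open>
  The restriction map \<open>X(D) \<rightarrow> X(D')\<close> is measurable for the constructibly Borel
  sets on both sides, so the pushforward is formed with these.  For countably generated \<open>D'\<close>
  the constructibly Borel sets of \<open>X(D')\<close> are exactly its Borel sets, as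
  \<^const>\<open>radon_measure\<close> demands.
\<close>

definition constructibly_radon ::
    "'a::{real_algebra_1, comm_ring_1} set \<Rightarrow> ('a \<Rightarrow> real) measure \<Rightarrow> bool" where
  "constructibly_radon D \<mu> \<longleftrightarrow>
     space \<mu> = characters D \<and>
     sets \<mu> = sets (constructible_borel D) \<and>
     (\<forall>D'. D' \<subseteq> D \<and> real_subalgebra D' \<and> countably_generated D' \<longrightarrow>
        radon_measure (character_topology D')
          (distr \<mu> (constructible_borel D') (\<lambda>\<alpha>. restrict \<alpha> D')))"

section \<open>Constructibly Radon measures on \<open>\<real>\<^sup>\<Omega>\<close>\<close>

definition real_power :: "'i set \<Rightarrow> ('i \<Rightarrow> real) set" where
  "real_power \<Omega> = (\<Pi>\<^sub>E i\<in>\<Omega>. UNIV)"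

definition point_eval :: "'i set \<Rightarrow> ('i \<Rightarrow> real) \<Rightarrow> ('i, real) mpoly \<Rightarrow> real" where
  "point_eval \<Omega> x = (\<lambda>p\<in>polys \<Omega>. poly_eval x p)"

text \<open>
  \<open>point_eval \<Omega>\<close> is the bijection identifying \<open>\<real>\<^sup>\<Omega>\<close> with the character space of the real
  polynomials (lemma \<open>bij_betw_point_eval\<close> below); measures are transported along it.  The last
  conjunct is the finiteness of all moments.
\<close>

definition constructibly_radon_on_power :: "'i set \<Rightarrow> ('i \<Rightarrow> real) measure \<Rightarrow> bool" where
  "constructibly_radon_on_power \<Omega> \<nu> \<longleftrightarrow>
     space \<nu> = real_power \<Omega> \<and>
     sets \<nu> = sets (vimage_algebra (real_power \<Omega>) (point_eval \<Omega>)
       (constructible_borel (polys \<Omega>))) \<and>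
     constructibly_radon (polys \<Omega>)
       (distr \<nu> (constructible_borel (polys \<Omega>)) (point_eval \<Omega>)) \<and>
     (\<forall>m. Poly_Mapping.keys m \<subseteq> \<Omega> \<longrightarrow>
        integrable \<nu> (\<lambda>x. poly_eval x (Poly_Mapping.single m 1)))"

section \<open>The spaces \<open>L\<^sup>s\<close>\<close>

definition Ls_norm :: "real \<Rightarrow> 'b measure \<Rightarrow> ('b \<Rightarrow> complex) \<Rightarrow> ennreal" where
  "Ls_norm s \<nu> f = (let I = (\<integral>\<^sup>+ x. ennreal (norm (f x) powr s) \<partial>\<nu>)
     in if I = \<infinity> then \<infinity> else ennreal (enn2real I powr (1 / s)))"

definition Ls_space :: "real \<Rightarrow> 'b measure \<Rightarrow> ('b \<Rightarrow> complex) set" where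
  "Ls_space s \<nu> = {f \<in> borel_measurable \<nu>. Ls_norm s \<nu> f < \<infinity>}"

definition dense_in_Ls :: "('b \<Rightarrow> complex) set \<Rightarrow> real \<Rightarrow> 'b measure \<Rightarrow> bool" where
  "dense_in_Ls F s \<nu> \<longleftrightarrow> F \<subseteq> Ls_space s \<nu> \<and>
     (\<forall>f\<in>Ls_space s \<nu>. \<forall>\<epsilon>>0. \<exists>g\<in>F. Ls_norm s \<nu> (\<lambda>x. g x - f x) < \<epsilon>)"

definition cpoly_fun :: "('i, complex) mpoly \<Rightarrow> ('i \<Rightarrow> real) \<Rightarrow> complex" where
  "cpoly_fun p x = poly_eval (\<lambda>i. complex_of_real (x i)) p"

section \<open>Point evaluations are the characters of the polynomial algebra\<close>

lemma poly_mapping_induct [case_names zero add]: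
  fixes p :: "'k \<Rightarrow>\<^sub>0 'v::comm_monoid_add"
  assumes "P 0"
    and "\<And>p k v. k \<notin> Poly_Mapping.keys p \<Longrightarrow> v \<noteq> 0 \<Longrightarrow> P p \<Longrightarrow> P (p + Poly_Mapping.single k v)"
  shows "P p"
proof (induction p rule: Poly_Mapping.update_induct)
  case const
  show ?case by fact
next
  case (update f a b)
  have "Poly_Mapping.update a b f = f + Poly_Mapping.single a b"
    using update by (intro poly_mapping_eqI)
      (auto simp: lookup_update lookup_add lookup_single when_def in_keys_iff)
  then show ?case using assms(2) update by metis
qed

lemma poly_eval_superset:
  assumes "finite S" "Poly_Mapping.keys p \<subseteq> S"
  shows "poly_eval x p = (\<Sum>m\<in>S. Poly_Mapping.lookup p m *
     (\<Prod>i \<in> Poly_Mapping.keys m. x i ^ Poly_Mapping.lookup m i))"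
  unfolding poly_eval_def
  by (rule sum.mono_neutral_left) (use assms in \<open>auto simp: in_keys_iff\<close>)

lemma poly_eval_0 [simp]: "poly_eval x 0 = 0"
  by (simp add: poly_eval_def)

lemma poly_eval_single: "poly_eval x (Poly_Mapping.single m c) =
    c * (\<Prod>i \<in> Poly_Mapping.keys m. x i ^ Poly_Mapping.lookup m i)"
  by (simp add: poly_eval_def)

lemma poly_eval_1 [simp]: "poly_eval x 1 = 1"
  using poly_eval_single[of x 0 1] by simp

lemma poly_eval_add: "poly_eval x (p + q) = poly_eval x p + poly_eval x q"
proof -
  let ?S = "Poly_Mapping.keys p \<union> Poly_Mapping.keys q"
  have "Poly_Mapping.keys (p + q) \<subseteq> ?S" by (rule keys_add)
  then show ?thesis
    by (simp add: poly_eval_superset[of ?S] lookup_add distrib_right sum.distrib)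
qed

lemma monom_eval_superset:
  fixes x :: "'i \<Rightarrow> 'a::comm_semiring_1"
  assumes "finite S" "Poly_Mapping.keys m \<subseteq> S"
  shows "(\<Prod>i \<in> Poly_Mapping.keys m. x i ^ Poly_Mapping.lookup m i)
    = (\<Prod>i \<in> S. x i ^ Poly_Mapping.lookup m i)"
  by (rule prod.mono_neutral_left) (use assms in \<open>auto simp: in_keys_iff\<close>)

lemma monom_eval_add:
  fixes x :: "'i \<Rightarrow> 'a::comm_semiring_1"
  shows "(\<Prod>i \<in> Poly_Mapping.keys (m + n). x i ^ Poly_Mapping.lookup (m + n) i)
    = (\<Prod>i \<in> Poly_Mapping.keys m. x i ^ Poly_Mapping.lookup m i) *
      (\<Prod>i \<in> Poly_Mapping.keys n. x i ^ Poly_Mapping.lookup n i)"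
proof -
  let ?S = "Poly_Mapping.keys m \<union> Poly_Mapping.keys n"
  have "Poly_Mapping.keys (m + n) \<subseteq> ?S" by (rule keys_add)
  then have "(\<Prod>i \<in> Poly_Mapping.keys (m + n). x i ^ Poly_Mapping.lookup (m + n) i)
      = (\<Prod>i \<in> ?S. x i ^ Poly_Mapping.lookup (m + n) i)"
    by (intro monom_eval_superset) auto
  then show ?thesis
    by (simp add: monom_eval_superset[of ?S m x] monom_eval_superset[of ?S n x]
        lookup_add power_add prod.distrib)
qed

lemma poly_eval_mult: "poly_eval x (p * q) = poly_eval x p * poly_eval x q"
proof (induction p rule: poly_mapping_induct)
  case (add p k v)
  have "poly_eval x (Poly_Mapping.single k v * q) = poly_eval x (Poly_Mapping.single k v) * poly_eval x q"
  proof (induction q rule: poly_mapping_induct)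
    case (add q l w)
    then show ?case
      by (simp add: poly_eval_add distrib_left mult_single poly_eval_single monom_eval_add mult_ac)
  qed simp
  with add show ?case by (simp add: poly_eval_add distrib_right)
qed simp

lemma keys_add_nat:
  fixes m n :: "'i \<Rightarrow>\<^sub>0 nat"
  shows "Poly_Mapping.keys (m + n) = Poly_Mapping.keys m \<union> Poly_Mapping.keys n"
  by (auto simp: in_keys_iff lookup_add)

lemma polys_add: "p \<in> polys \<Omega> \<Longrightarrow> q \<in> polys \<Omega> \<Longrightarrow> p + q \<in> polys \<Omega>"
  unfolding polys_def using keys_add[of p q] by blast

lemma polys_mult:
  fixes p q :: "('i, 'a::semiring_0) mpoly"
  shows "p \<in> polys \<Omega> \<Longrightarrow> q \<in> polys \<Omega> \<Longrightarrow> p * q \<in> polys \<Omega>"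
  unfolding polys_def using keys_mult[of p q] by (fastforce simp: keys_add_nat)

lemma single_in_polys: "Poly_Mapping.keys m \<subseteq> \<Omega> \<Longrightarrow> Poly_Mapping.single m c \<in> polys \<Omega>"
  by (auto simp: polys_def)

lemma one_in_polys [simp]: "(1 :: ('i, 'a::zero_neq_one) mpoly) \<in> polys \<Omega>"
  by (auto simp: polys_def)

lemma real_ring_hom_id:
  fixes g :: "real \<Rightarrow> real"
  assumes one: "g 1 = 1" and add: "\<And>a b. g (a + b) = g a + g b"
    and mult: "\<And>a b. g (a * b) = g a * g b"
  shows "g c = c"
proof -
  interpret additive g by standard (rule add)
  have nat: "g (real n) = real n" for n
    by (induction n) (simp_all add: zero add one)
  have int: "g (real_of_int k) = real_of_int k" for k
    by (cases k) (simp_all add: nat minus diff one)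
  have rat: "g (of_rat q) = of_rat q" for q
  proof -
    obtain a b where q: "q = Fract a b" "b > 0"
      by (metis Rat_cases)
    have "real_of_int b * g (of_rat q) = g (real_of_int b * of_rat q)"
      by (simp add: mult int)
    also have "real_of_int b * of_rat q = real_of_int a"
      using q by (simp add: of_rat_rat)
    finally show ?thesis using q by (simp add: int of_rat_rat field_simps)
  qed
  have pos: "g a \<ge> 0" if "a \<ge> 0" for a
    using mult[of "sqrt a" "sqrt a"] that by simp
  have mono: "g a \<le> g b" if "a \<le> b" for a b
    using pos[of "b - a"] that by (simp add: diff)
  show ?thesis
  proof (rule ccontr)
    assume "g c \<noteq> c"
    then consider "g c < c" | "c < g c" by linarith
    then show False
    proof cases
      case 1
      then obtain q where "g c < of_rat q" "of_rat q < c" using of_rat_dense by blast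
      then show False using mono[of "of_rat q" c] by (simp add: rat)
    next
      case 2
      then obtain q where "c < of_rat q" "of_rat q < g c" using of_rat_dense by blast
      then show False using mono[of c "of_rat q"] by (simp add: rat)
    qed
  qed
qed

lemma bij_betw_point_eval:
  fixes \<Omega> :: "'i set"
  shows "bij_betw (point_eval \<Omega>) (real_power \<Omega>) (characters (polys \<Omega>))"
  unfolding bij_betw_def
proof
  let ?X = "\<lambda>i. Poly_Mapping.single (Poly_Mapping.single i 1) 1 :: ('i, real) mpoly"
  have X: "?X i \<in> polys \<Omega>" if "i \<in> \<Omega>" for i
    using that by (intro single_in_polys) auto
  have eval_X: "poly_eval x (?X i) = x i" for x i
    by (simp add: poly_eval_single)
  show "inj_on (point_eval \<Omega>) (real_power \<Omega>)"
  proof (rule inj_onI)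
    fix x y assume xy: "x \<in> real_power \<Omega>" "y \<in> real_power \<Omega>" "point_eval \<Omega> x = point_eval \<Omega> y"
    show "x = y"
    proof (rule PiE_ext)
      fix i assume "i \<in> \<Omega>"
      then have "poly_eval x (?X i) = poly_eval y (?X i)"
        using fun_cong[OF xy(3), of "?X i"] X by (simp add: point_eval_def)
      then show "x i = y i" by (simp only: eval_X)
    qed (use xy in \<open>simp_all add: real_power_def\<close>)
  qed
  show "point_eval \<Omega> ` real_power \<Omega> = characters (polys \<Omega>)"
  proof
    show "point_eval \<Omega> ` real_power \<Omega> \<subseteq> characters (polys \<Omega>)"
      by (auto simp: characters_def point_eval_def polys_add polys_mult poly_eval_add poly_eval_mult)
    show "characters (polys \<Omega>) \<subseteq> point_eval \<Omega> ` real_power \<Omega>"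
    proof
      fix \<alpha> :: "('i, real) mpoly \<Rightarrow> real" assume \<alpha>: "\<alpha> \<in> characters (polys \<Omega>)"
      have ext: "\<alpha> \<in> extensional (polys \<Omega>)" and one: "\<alpha> 1 = 1"
        and add: "\<And>p q. p \<in> polys \<Omega> \<Longrightarrow> q \<in> polys \<Omega> \<Longrightarrow> \<alpha> (p + q) = \<alpha> p + \<alpha> q"
        and mult: "\<And>p q. p \<in> polys \<Omega> \<Longrightarrow> q \<in> polys \<Omega> \<Longrightarrow> \<alpha> (p * q) = \<alpha> p * \<alpha> q"
        using \<alpha> by (auto simp: characters_def)
      define x where "x = (\<lambda>i\<in>\<Omega>. \<alpha> (?X i))"
      have x: "x \<in> real_power \<Omega>" by (simp add: x_def real_power_def)
      have const: "\<alpha> (Poly_Mapping.single 0 c) = c" for c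
      proof (rule real_ring_hom_id[where g = "\<lambda>c. \<alpha> (Poly_Mapping.single 0 c)"])
        show "\<alpha> (Poly_Mapping.single 0 1) = 1" using one by simp
      next
        fix a b :: real
        show "\<alpha> (Poly_Mapping.single 0 (a + b)) =
            \<alpha> (Poly_Mapping.single 0 a) + \<alpha> (Poly_Mapping.single 0 b)"
          by (simp add: single_add add single_in_polys)
        have "Poly_Mapping.single 0 (a * b) =
            Poly_Mapping.single (0 :: 'i \<Rightarrow>\<^sub>0 nat) a * Poly_Mapping.single 0 b"
          by (simp add: mult_single)
        then show "\<alpha> (Poly_Mapping.single 0 (a * b)) =
            \<alpha> (Poly_Mapping.single 0 a) * \<alpha> (Poly_Mapping.single 0 b)"
          by (simp add: mult single_in_polys)
      qed
      have pow: "\<alpha> (Poly_Mapping.single (Poly_Mapping.single i n) 1) = x i ^ n" if i: "i \<in> \<Omega>" for i n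
      proof (induction n)
        case 0
        then show ?case by (simp add: one)
      next
        case (Suc n)
        have "Poly_Mapping.single (Poly_Mapping.single i (Suc n)) 1 =
            ?X i * Poly_Mapping.single (Poly_Mapping.single i n) 1"
          by (simp add: mult_single single_add[symmetric])
        moreover have "Poly_Mapping.single (Poly_Mapping.single i n) (1::real) \<in> polys \<Omega>"
          using i by (intro single_in_polys) (auto split: if_splits)
        ultimately show ?case
          using Suc X[OF i] i by (simp add: mult x_def)
      qed
      have monom: "\<alpha> (Poly_Mapping.single m 1) = poly_eval x (Poly_Mapping.single m 1)"
        if "Poly_Mapping.keys m \<subseteq> \<Omega>" for m
        using that
      proof (induction m rule: poly_mapping_induct)
        case zero
        show ?case by (simp add: one)
      next
        case (add m i n)
        then have i: "i \<in> \<Omega>" and m: "Poly_Mapping.keys m \<subseteq> \<Omega>"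
          by (auto simp: keys_add_nat)
        have eq: "Poly_Mapping.single (m + Poly_Mapping.single i n) (1::real) =
            Poly_Mapping.single m 1 * Poly_Mapping.single (Poly_Mapping.single i n) 1"
          by (simp add: mult_single)
        have "poly_eval x (Poly_Mapping.single (Poly_Mapping.single i n) 1) = x i ^ n"
          by (simp add: poly_eval_single)
        moreover have "Poly_Mapping.single (Poly_Mapping.single i n) (1::real) \<in> polys \<Omega>"
          using i by (intro single_in_polys) (auto split: if_splits)
        ultimately show ?case
          unfolding eq using add.IH m mult[OF single_in_polys[OF m, of 1]]
          by (simp add: poly_eval_mult pow i)
      qed
      have "\<alpha> p = poly_eval x p" if "p \<in> polys \<Omega>" for p
        using that
      proof (induction p rule: poly_mapping_induct)
        case zero
        show ?case using const[of 0] by simp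
      next
        case (add p m c)
        have "Poly_Mapping.keys (p + Poly_Mapping.single m c) =
            insert m (Poly_Mapping.keys p)"
          using add.hyps by (auto simp: in_keys_iff lookup_add lookup_single when_def split: if_splits)
        with add.prems have p: "p \<in> polys \<Omega>" and m: "Poly_Mapping.keys m \<subseteq> \<Omega>"
          by (auto simp: polys_def)
        have eq: "Poly_Mapping.single m c = Poly_Mapping.single 0 c * Poly_Mapping.single m 1"
          by (simp add: mult_single)
        have "\<alpha> (Poly_Mapping.single m c) = poly_eval x (Poly_Mapping.single m c)"
          unfolding eq using monom[OF m] mult[OF _ single_in_polys[OF m, of 1]]
          by (simp add: poly_eval_mult single_in_polys const)
            (simp add: poly_eval_single)
        then show ?case
          using \<open>\<And>p q. p \<in> polys \<Omega> \<Longrightarrow> q \<in> polys \<Omega> \<Longrightarrow> \<alpha> (p + q) = \<alpha> p + \<alpha> q\<close>[OF p single_in_polys[OF m]]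
            add.IH p by (simp add: poly_eval_add)
      qed
      then have "\<alpha> = point_eval \<Omega> x"
        using ext by (auto simp: point_eval_def extensional_def fun_eq_iff)
      with x show "\<alpha> \<in> point_eval \<Omega> ` real_power \<Omega>" by blast
    qed
  qed
qed

end

theory Submission
  imports Defs
begin

text \<open>
  Fix \<open>1 \<le> t < s\<close>, let \<open>F\<close> be the algebra of polynomial functions and \<open>C\<close> its closure in
  \<open>L\<^sup>t\<close>.  Call a bounded measurable \<open>h\<close> a multiplier if \<open>h C \<subseteq> C\<close>.  If \<open>q\<^sub>k \<rightarrow> f\<close> in \<open>L\<^sup>s\<close>
  with \<open>q\<^sub>k\<close> polynomial and \<open>f\<close> bounded, then \<open>p q\<^sub>k \<rightarrow> p f\<close> in \<open>L\<^sup>t\<close> for every polynomial \<open>p\<close>,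
  because \<open>p\<close> has all moments and \<open>t < s\<close>; hence \<open>f\<close> is a multiplier, and so are
  \<open>1 / (x\<^sub>j - \<i>)\<close> and its conjugate.  The multipliers form an algebra closed under bounded pointwise
  limits, so the sets with multiplier indicator form a \<open>\<sigma>\<close>-algebra.  By Weierstrass approximation
  the real and imaginary parts of \<open>1 / (x\<^sub>j - \<i>)\<close> are measurable for it, and therefore so is
  \<open>x\<^sub>j\<close>.  Thus it contains every measurable set, and as \<open>1 \<in> C\<close> all simple functions lie in \<open>C\<close>.
\<close>

section \<open>The \<open>t\<close>-th absolute moment of a function\<close>

text \<open>
  Working with \<open>\<integral> |f|\<^sup>t\<close> rather than its \<open>t\<close>-th root, a triangle inequality up to the constant
  \<open>2\<^sup>t\<close> suffices and Minkowski's inequality is not needed.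
\<close>

definition Ls_int :: "real \<Rightarrow> 'b measure \<Rightarrow> ('b \<Rightarrow> complex) \<Rightarrow> ennreal" where
  "Ls_int t M f = (\<integral>\<^sup>+ x. ennreal (norm (f x) powr t) \<partial>M)"

text \<open>Taking the \<open>t\<close>-th root is strictly increasing, and an infinite integral
  makes both sides false. By this equivalence the hypothesis and the conclusion on norms become
  statements on \<open>Ls_int\<close>.\<close>

lemma Ls_norm_less_iff:
  assumes "0 < t" "0 < e"
  shows "Ls_norm t M f < ennreal e \<longleftrightarrow> Ls_int t M f < ennreal (e powr t)"
proof (cases "Ls_int t M f")
  case top
  then show ?thesis by (simp add: Ls_norm_def Ls_int_def)
next
  case (real r)
  then have "Ls_norm t M f = ennreal (r powr (1 / t))"
    by (simp add: Ls_norm_def flip: Ls_int_def)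
  moreover have "r powr (1 / t) < e \<longleftrightarrow> r < e powr t"
  proof -
    have "r powr (1 / t) < e \<longleftrightarrow> (r powr (1 / t)) powr t < e powr t"
      using assms by (metis less_eq_real_def not_less powr_less_mono2 powr_mono2 powr_ge_zero)
    then show ?thesis using assms real by (simp add: powr_powr)
  qed
  ultimately show ?thesis
    using real assms by (simp add: ennreal_less_iff)
qed

lemma Ls_norm_finite_iff: "Ls_norm t M f < \<infinity> \<longleftrightarrow> Ls_int t M f < \<infinity>"
  unfolding Ls_norm_def Ls_int_def[symmetric] Let_def by (auto simp: less_top[symmetric])

lemma Ls_int_cong:
  assumes "\<And>x. x \<in> space M \<Longrightarrow> norm (f x) = norm (g x)"
  shows "Ls_int t M f = Ls_int t M g"
  unfolding Ls_int_def using assms by (intro nn_integral_cong) simp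

lemma Ls_int_minus_commute: "Ls_int t M (\<lambda>x. f x - g x) = Ls_int t M (\<lambda>x. g x - f x)"
  by (intro Ls_int_cong norm_minus_commute)

lemma Ls_int_mono:
  assumes "0 \<le> t" "\<And>x. x \<in> space M \<Longrightarrow> norm (f x) \<le> norm (g x)"
  shows "Ls_int t M f \<le> Ls_int t M g"
  unfolding Ls_int_def using assms by (intro nn_integral_mono ennreal_leI powr_mono2) auto

lemma Ls_int_scale:
  assumes "f \<in> borel_measurable M"
  shows "Ls_int t M (\<lambda>x. c * f x) = ennreal (norm c powr t) * Ls_int t M f"
proof -
  have "ennreal (norm (c * f x) powr t) = ennreal (norm c powr t) * ennreal (norm (f x) powr t)" for x
    by (simp add: norm_mult powr_mult ennreal_mult)
  then show ?thesis
    unfolding Ls_int_def using assms by (simp add: nn_integral_cmult)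
qed

text \<open>The sum is at most twice the maximum, and the \<open>t\<close>-th power of the maximum
  is one of the two powers on the right.\<close>

lemma powr_add_le:
  fixes a b t :: real
  assumes "0 < t" "0 \<le> a" "0 \<le> b"
  shows "(a + b) powr t \<le> 2 powr t * (a powr t + b powr t)"
proof -
  have "(a + b) powr t \<le> (2 * max a b) powr t"
    using assms by (intro powr_mono2) auto
  also have "\<dots> = 2 powr t * max a b powr t"
    using assms by (simp add: powr_mult)
  also have "max a b powr t \<le> a powr t + b powr t"
    by (auto simp: max_def)
  finally show ?thesis by simp
qed

lemma Ls_int_add_le:
  assumes "0 < t" "f \<in> borel_measurable M" "g \<in> borel_measurable M"
  shows "Ls_int t M (\<lambda>x. f x + g x) \<le> ennreal (2 powr t) * (Ls_int t M f + Ls_int t M g)"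
proof -
  have "Ls_int t M (\<lambda>x. f x + g x)
      \<le> (\<integral>\<^sup>+ x. ennreal (2 powr t) * (ennreal (norm (f x) powr t) + ennreal (norm (g x) powr t)) \<partial>M)"
    unfolding Ls_int_def
  proof (rule nn_integral_mono)
    fix x
    have "norm (f x + g x) powr t \<le> (norm (f x) + norm (g x)) powr t"
      using assms by (intro powr_mono2 norm_triangle_ineq) auto
    also have "\<dots> \<le> 2 powr t * (norm (f x) powr t + norm (g x) powr t)"
      using assms by (intro powr_add_le) auto
    finally have "ennreal (norm (f x + g x) powr t)
        \<le> ennreal (2 powr t * (norm (f x) powr t + norm (g x) powr t))"
      by (rule ennreal_leI)
    then show "ennreal (norm (f x + g x) powr t)
        \<le> ennreal (2 powr t) * (ennreal (norm (f x) powr t) + ennreal (norm (g x) powr t))"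
      by (simp add: ennreal_mult)
  qed
  also have "\<dots> = ennreal (2 powr t) * (Ls_int t M f + Ls_int t M g)"
    unfolding Ls_int_def using assms by (simp add: nn_integral_cmult nn_integral_add)
  finally show ?thesis .
qed

text \<open>The threshold is half of \<open>e\<close> divided by the constant
  \<open>2 powr t\<close> of the weak triangle inequality; every later argument with two
  approximation errors takes this value.\<close>

lemma Ls_int_add_less:
  assumes "0 < t" "f \<in> borel_measurable M" "g \<in> borel_measurable M" "0 < e"
    and "Ls_int t M f < ennreal (e / (2 * 2 powr t))" "Ls_int t M g < ennreal (e / (2 * 2 powr t))"
  shows "Ls_int t M (\<lambda>x. f x + g x) < ennreal e"
proof -
  obtain a b where ab: "Ls_int t M f = ennreal a" "Ls_int t M g = ennreal b" "0 \<le> a" "0 \<le> b"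
    using assms(5,6) by (metis ennreal_cases not_less top_greatest)
  then have "a < e / (2 * 2 powr t)" "b < e / (2 * 2 powr t)"
    using assms(5,6) by (simp_all add: ennreal_less_iff)
  then have "2 powr t * (a + b) < e"
    by (simp add: field_simps)
  then have "ennreal (2 powr t) * (Ls_int t M f + Ls_int t M g) < ennreal e"
    using ab by (simp add: ennreal_less_iff flip: ennreal_plus ennreal_mult)
  with Ls_int_add_le[OF assms(1-3)] show ?thesis by (rule le_less_trans)
qed

text \<open>Takes the place of Hoelder's inequality: the weight \<open>\<eta>\<close> is chosen small before \<open>b\<close> is.\<close>

lemma mult_le_powr_sum:
  fixes a b r \<eta> :: real
  assumes "0 \<le> a" "0 \<le> b" "1 < r" "0 < \<eta>"
  shows "a * b \<le> \<eta> powr (1 - r) * b powr r + \<eta> * a powr (r / (r - 1))"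
\<comment> \<open>At this threshold the two terms on the right agree. Below it the second one bounds
  the product; above it \<open>a\<close> is at most \<open>(b / \<eta>) powr (r - 1)\<close>, and
  the first one does.\<close>
proof (cases "b \<le> \<eta> * a powr (1 / (r - 1))")
  case True
  have "a * b \<le> a * (\<eta> * a powr (1 / (r - 1)))"
    using True assms by (intro mult_left_mono) auto
  also have "\<dots> = \<eta> * (a powr 1 * a powr (1 / (r - 1)))"
    using assms by simp
  also have "a powr 1 * a powr (1 / (r - 1)) = a powr (1 + 1 / (r - 1))"
    by (rule powr_add[symmetric])
  also have "1 + 1 / (r - 1) = r / (r - 1)"
    using assms by (simp add: field_simps)
  finally show ?thesis by (simp add: add_increasing)
next
  case False
  then have "a powr (1 / (r - 1)) \<le> b / \<eta>" using assms by (simp add: field_simps)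
  then have "(a powr (1 / (r - 1))) powr (r - 1) \<le> (b / \<eta>) powr (r - 1)"
    using assms by (intro powr_mono2) auto
  then have "a \<le> (b / \<eta>) powr (r - 1)" using assms by (simp add: powr_powr)
  then have "a * b \<le> (b / \<eta>) powr (r - 1) * b"
    using assms by (intro mult_right_mono) auto
  also have "\<dots> = (1 / \<eta>) powr (r - 1) * (b powr (r - 1) * b powr 1)"
    using assms by (simp add: powr_divide)
  also have "(1 / \<eta>) powr (r - 1) = \<eta> powr (1 - r)"
    using assms by (simp add: powr_divide powr_diff)
  also have "b powr (r - 1) * b powr 1 = b powr r"
    by (metis powr_add diff_add_cancel)
  finally show ?thesis using assms by (simp add: add_increasing2)
qed

section \<open>Multiplication by a function with finite moments\<close>

text \<open>The pointwise bound is integrated for \<open>|p|^t\<close> and \<open>|u|^t\<close> with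
  \<open>r = s / t\<close>; the conjugate exponent \<open>r / (r - 1)\<close> produces the moment of
  \<open>p\<close> of order \<open>s * t / (s - t)\<close>.\<close>

lemma Ls_int_mult_le:
  assumes "0 < t" "t < s" "0 < \<eta>" "p \<in> borel_measurable M" "u \<in> borel_measurable M"
  shows "Ls_int t M (\<lambda>x. p x * u x) \<le>
    ennreal (\<eta> powr (1 - s / t)) * Ls_int s M u + ennreal \<eta> * Ls_int (s * t / (s - t)) M p"
proof -
  have "Ls_int t M (\<lambda>x. p x * u x) \<le>
      (\<integral>\<^sup>+ x. ennreal (\<eta> powr (1 - s / t)) * ennreal (norm (u x) powr s) +
        ennreal \<eta> * ennreal (norm (p x) powr (s * t / (s - t))) \<partial>M)"
    unfolding Ls_int_def
  proof (rule nn_integral_mono)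
    fix x
    have "norm (p x) powr t * norm (u x) powr t \<le>
        \<eta> powr (1 - s / t) * (norm (u x) powr t) powr (s / t) +
        \<eta> * (norm (p x) powr t) powr (s / t / (s / t - 1))"
      using assms by (intro mult_le_powr_sum) auto
    also have "(norm (u x) powr t) powr (s / t) = norm (u x) powr s"
      using assms by (simp add: powr_powr)
    also have "(norm (p x) powr t) powr (s / t / (s / t - 1)) = norm (p x) powr (s * t / (s - t))"
      using assms by (simp add: powr_powr field_simps)
    finally have "norm (p x * u x) powr t \<le> \<eta> powr (1 - s / t) * norm (u x) powr s +
        \<eta> * norm (p x) powr (s * t / (s - t))"
      by (simp add: norm_mult powr_mult)
    then show "ennreal (norm (p x * u x) powr t) \<le>
        ennreal (\<eta> powr (1 - s / t)) * ennreal (norm (u x) powr s) +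
        ennreal \<eta> * ennreal (norm (p x) powr (s * t / (s - t)))"
      using assms(3) by (simp add: ennreal_leI flip: ennreal_mult ennreal_plus)
  qed
  also have "\<dots> = ennreal (\<eta> powr (1 - s / t)) * Ls_int s M u +
      ennreal \<eta> * Ls_int (s * t / (s - t)) M p"
    unfolding Ls_int_def using assms by (simp add: nn_integral_add nn_integral_cmult)
  finally show ?thesis .
qed

text \<open>This is continuity at zero of multiplication by \<open>p\<close> from L^s to L^t; the
  drop from \<open>s\<close> to \<open>t\<close> pays for \<open>p\<close> being unbounded.\<close>

lemma Ls_int_mult_small:
  assumes "0 < t" "t < s" "0 < e" "p \<in> borel_measurable M" "Ls_int (s * t / (s - t)) M p < \<infinity>"
  shows "\<exists>d>0. \<forall>u\<in>borel_measurable M. Ls_int s M u < ennreal d \<longrightarrow>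
    Ls_int t M (\<lambda>x. p x * u x) < ennreal e"
proof -
  obtain P where P: "Ls_int (s * t / (s - t)) M p = ennreal P" "0 \<le> P"
    using assms(5) by (cases "Ls_int (s * t / (s - t)) M p") auto
  \<comment> \<open>The weight makes the fixed moment \<open>P\<close> contribute less than
    \<open>e / 2\<close>, the summand 1 giving strictness and covering \<open>P = 0\<close>; then
    \<open>d\<close> makes the other term at most \<open>e / 2\<close>.\<close>
  define \<eta> where "\<eta> = e / (2 * (P + 1))"
  define K where "K = \<eta> powr (1 - s / t)"
  define d where "d = e / (2 * K)"
  have \<eta>: "0 < \<eta>" using assms(3) P(2) by (simp add: \<eta>_def)
  then have K: "0 < K" by (simp add: K_def)
  have \<eta>P: "\<eta> * P < e / 2"
    using assms(3) P(2) by (simp add: \<eta>_def field_simps)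
  have d: "0 < d" using assms(3) K by (simp add: d_def)
  have "Ls_int t M (\<lambda>x. p x * u x) < ennreal e"
    if u: "u \<in> borel_measurable M" "Ls_int s M u < ennreal d" for u
  proof -
    have "Ls_int t M (\<lambda>x. p x * u x) \<le> ennreal K * Ls_int s M u + ennreal \<eta> * ennreal P"
      unfolding K_def P(1)[symmetric] using assms \<eta> u by (intro Ls_int_mult_le)
    also have "\<dots> \<le> ennreal K * ennreal d + ennreal \<eta> * ennreal P"
      using u(2) by (intro add_right_mono mult_left_mono) auto
    also have "\<dots> = ennreal (K * d + \<eta> * P)"
      using K d \<eta> P(2) by (simp add: ennreal_mult)
    also have "\<dots> < ennreal e"
      using K \<eta>P assms(3) by (intro ennreal_lessI) (auto simp: d_def)
    finally show ?thesis .
  qed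
  with d show ?thesis by blast
qed

section \<open>Bounded multipliers of a closed subspace\<close>

text \<open>Finite moments of the members are a consequence (\<open>closure_fin\<close>): a finite
  approximation error transfers them from \<open>F\<close>.\<close>

definition Ls_closure :: "real \<Rightarrow> 'b measure \<Rightarrow> ('b \<Rightarrow> complex) set \<Rightarrow> ('b \<Rightarrow> complex) set" where
  "Ls_closure t M F = {f \<in> borel_measurable M.
     \<forall>e>0. \<exists>g\<in>F. Ls_int t M (\<lambda>x. f x - g x) < ennreal e}"

text \<open>Multipliers are closed under products, while a closed subspace \<open>C\<close> need not
  be.\<close>

definition bounded_multipliers :: "'b measure \<Rightarrow> ('b \<Rightarrow> complex) set \<Rightarrow> ('b \<Rightarrow> complex) set" where
  "bounded_multipliers M C = {h \<in> borel_measurable M.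
     (\<exists>B. \<forall>x\<in>space M. norm (h x) \<le> B) \<and> (\<forall>g\<in>C. (\<lambda>x. h x * g x) \<in> C)}"

text \<open>\<open>F\<close> abstracts the polynomial functions. The constant 1 in \<open>F\<close>
  is what puts every multiplier into the closure.\<close>

locale Ls_subspace =
  fixes M :: "'b measure" and t :: real and F :: "('b \<Rightarrow> complex) set"
  assumes t_pos: "0 < t"
    and F_meas: "f \<in> F \<Longrightarrow> f \<in> borel_measurable M"
    and F_fin: "f \<in> F \<Longrightarrow> Ls_int t M f < \<infinity>"
    and F_add: "f \<in> F \<Longrightarrow> g \<in> F \<Longrightarrow> (\<lambda>x. f x + g x) \<in> F"
    and F_scale: "f \<in> F \<Longrightarrow> (\<lambda>x. c * f x) \<in> F"
    and F_one: "(\<lambda>x. 1) \<in> F"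
begin

abbreviation "C \<equiv> Ls_closure t M F"
abbreviation "H \<equiv> bounded_multipliers M C"

section \<open>Closure properties of the subspace\<close>

lemma closure_meas: "f \<in> C \<Longrightarrow> f \<in> borel_measurable M"
  by (simp add: Ls_closure_def)

lemma closure_approx: "f \<in> C \<Longrightarrow> 0 < e \<Longrightarrow> \<exists>g\<in>F. Ls_int t M (\<lambda>x. f x - g x) < ennreal e"
  by (simp add: Ls_closure_def)

lemma subset_closure: "F \<subseteq> C"
proof
  fix f assume "f \<in> F"
  then show "f \<in> C"
    unfolding Ls_closure_def using t_pos F_meas
    by (auto simp: Ls_int_def intro!: bexI[of _ f])
qed

lemma closure_fin:
  assumes "f \<in> C"
  shows "Ls_int t M f < \<infinity>"
proof -
  obtain g where g: "g \<in> F" "Ls_int t M (\<lambda>x. f x - g x) < ennreal 1"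
    using closure_approx[OF assms zero_less_one] by blast
  have "Ls_int t M (\<lambda>x. (f x - g x) + g x)
      \<le> ennreal (2 powr t) * (Ls_int t M (\<lambda>x. f x - g x) + Ls_int t M g)"
    using closure_meas[OF assms] F_meas[OF g(1)] t_pos
    by (intro Ls_int_add_le borel_measurable_diff)
  also have "\<dots> < \<infinity>"
    using less_trans[OF g(2) ennreal_less_top] F_fin[OF g(1)]
    by (simp add: ennreal_mult_less_top)
  finally show ?thesis by simp
qed

lemma closure_closed:
  assumes "f \<in> borel_measurable M" "\<And>e. 0 < e \<Longrightarrow> \<exists>g\<in>C. Ls_int t M (\<lambda>x. f x - g x) < ennreal e"
  shows "f \<in> C"
  unfolding Ls_closure_def
proof (safe intro!: assms(1))
  fix e :: real assume "0 < e"
  define d where "d = e / (2 * 2 powr t)"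
  have d: "0 < d" using \<open>0 < e\<close> by (simp add: d_def)
  obtain g where g: "g \<in> C" "Ls_int t M (\<lambda>x. f x - g x) < ennreal d" using assms(2) d by blast
  obtain p where p: "p \<in> F" "Ls_int t M (\<lambda>x. g x - p x) < ennreal d"
    using g(1) d by (auto simp: Ls_closure_def)
  have "Ls_int t M (\<lambda>x. (f x - g x) + (g x - p x)) < ennreal e"
    using assms(1) closure_meas[OF g(1)] F_meas[OF p(1)] g(2) p(2) \<open>0 < e\<close> t_pos
    by (intro Ls_int_add_less borel_measurable_diff) (auto simp: d_def)
  with p(1) show "\<exists>g\<in>F. Ls_int t M (\<lambda>x. f x - g x) < ennreal e" by auto
qed

lemma closure_add:
  assumes "f \<in> C" "g \<in> C"
  shows "(\<lambda>x. f x + g x) \<in> C"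
  unfolding Ls_closure_def
proof safe
  show "(\<lambda>x. f x + g x) \<in> borel_measurable M"
    using assms[THEN closure_meas] by measurable
  fix e :: real assume e: "0 < e"
  define d where "d = e / (2 * 2 powr t)"
  have d: "0 < d" using e by (simp add: d_def)
  obtain p q where p: "p \<in> F" "Ls_int t M (\<lambda>x. f x - p x) < ennreal d"
    and q: "q \<in> F" "Ls_int t M (\<lambda>x. g x - q x) < ennreal d"
    using assms d unfolding Ls_closure_def by blast
  have "Ls_int t M (\<lambda>x. (f x - p x) + (g x - q x)) < ennreal e"
    using closure_meas[OF assms(1)] closure_meas[OF assms(2)] F_meas[OF p(1)] F_meas[OF q(1)]
      p(2) q(2) e t_pos
    by (intro Ls_int_add_less borel_measurable_diff) (auto simp: d_def)
  then have "Ls_int t M (\<lambda>x. (f x + g x) - (p x + q x)) < ennreal e"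
    by (simp add: algebra_simps)
  then show "\<exists>r\<in>F. Ls_int t M (\<lambda>x. f x + g x - r x) < ennreal e"
    using F_add[OF p(1) q(1)] by (intro bexI[of _ "\<lambda>x. p x + q x"])
qed

text \<open>Dominated convergence is applied to \<open>|g - f n|^t\<close>, so the majorant
  \<open>w\<close> bounds the differences rather than the \<open>f n\<close> themselves;
  \<open>closure_closed\<close> then gives membership.\<close>

lemma closure_dominated:
  assumes "\<And>n. f n \<in> C" "w \<in> borel_measurable M" "Ls_int t M w < \<infinity>"
    and "\<And>n x. x \<in> space M \<Longrightarrow> norm (g x - f n x) \<le> norm (w x :: complex)"
    and "\<And>x. x \<in> space M \<Longrightarrow> (\<lambda>n. f n x) \<longlonglongrightarrow> g x"
  shows "g \<in> C"
proof (rule closure_closed)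
  have fm: "f n \<in> borel_measurable M" for n using assms(1) by (rule closure_meas)
  show gm: "g \<in> borel_measurable M"
    using fm assms(5) by (rule borel_measurable_LIMSEQ_metric)
  have "(\<lambda>n. \<integral>\<^sup>+ x. ennreal (norm (g x - f n x) powr t) \<partial>M) \<longlonglongrightarrow> (\<integral>\<^sup>+ x. 0 \<partial>M)"
  proof (rule nn_integral_dominated_convergence[where w = "\<lambda>x. ennreal (norm (w x) powr t)"])
    show "(\<integral>\<^sup>+ x. ennreal (norm (w x) powr t) \<partial>M) < \<infinity>"
      using assms(3) by (simp add: Ls_int_def)
    show "AE x in M. ennreal (norm (g x - f n x) powr t) \<le> ennreal (norm (w x) powr t)" for n
      using assms(4) t_pos by (intro AE_I2 ennreal_leI powr_mono2) auto
    show "AE x in M. (\<lambda>n. ennreal (norm (g x - f n x) powr t)) \<longlonglongrightarrow> 0"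
    proof (rule AE_I2)
      fix x assume "x \<in> space M"
      then have "(\<lambda>n. norm (g x - f n x)) \<longlonglongrightarrow> norm (g x - g x)"
        by (intro tendsto_intros assms(5))
      then have "(\<lambda>n. norm (g x - f n x) powr t) \<longlonglongrightarrow> 0"
        using t_pos by (intro tendsto_zero_powrI[where b = t]) auto
      then show "(\<lambda>n. ennreal (norm (g x - f n x) powr t)) \<longlonglongrightarrow> 0"
        using tendsto_ennrealI by force
    qed
  qed (use fm gm assms(2) in measurable)
  then have lim: "(\<lambda>n. Ls_int t M (\<lambda>x. g x - f n x)) \<longlonglongrightarrow> 0"
    by (simp add: Ls_int_def)
  fix e :: real assume "0 < e"
  then have "\<forall>\<^sub>F n in sequentially. Ls_int t M (\<lambda>x. g x - f n x) < ennreal e"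
    using order_tendstoD(2)[OF lim] by simp
  then show "\<exists>f\<in>C. Ls_int t M (\<lambda>x. g x - f x) < ennreal e"
    using assms(1) by (auto simp: eventually_sequentially)
qed

section \<open>The algebra of multipliers and its bounded limits\<close>

lemma multiplier_meas: "h \<in> H \<Longrightarrow> h \<in> borel_measurable M"
  by (simp add: bounded_multipliers_def)

lemma multiplier_closure: "h \<in> H \<Longrightarrow> g \<in> C \<Longrightarrow> (\<lambda>x. h x * g x) \<in> C"
  unfolding bounded_multipliers_def by blast

lemma multiplier_bounded: "h \<in> H \<Longrightarrow> \<exists>B. \<forall>x\<in>space M. norm (h x) \<le> B"
  unfolding bounded_multipliers_def by (elim CollectE conjE)

lemma multiplierI:
  assumes "h \<in> borel_measurable M" "\<And>x. x \<in> space M \<Longrightarrow> norm (h x) \<le> B"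
    and "\<And>g. g \<in> C \<Longrightarrow> (\<lambda>x. h x * g x) \<in> C"
  shows "h \<in> H"
  unfolding bounded_multipliers_def by (intro CollectI conjI exI[of _ B] ballI assms)

lemma multiplier_in_closure:
  assumes "h \<in> H"
  shows "h \<in> C"
proof -
  have "(\<lambda>x. h x * 1) \<in> C"
    using assms subsetD[OF subset_closure F_one] by (rule multiplier_closure)
  then show ?thesis by simp
qed

text \<open>The bound \<open>B\<close> passes to the limit \<open>k\<close>, so for each
  \<open>g\<close> in \<open>C\<close> the errors \<open>(k - h n) g\<close> are dominated by
  \<open>2 B |g|\<close>, which has a finite moment by \<open>closure_fin\<close>.\<close>

lemma multiplier_dominated:
  assumes "\<And>n. h n \<in> H" "\<And>n x. x \<in> space M \<Longrightarrow> norm (h n x) \<le> B"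
    and lim: "\<And>x. x \<in> space M \<Longrightarrow> (\<lambda>n. h n x) \<longlonglongrightarrow> k x"
  shows "k \<in> H"
proof -
  have km: "k \<in> borel_measurable M"
    using multiplier_meas[OF assms(1)] lim by (rule borel_measurable_LIMSEQ_metric)
  have kB: "norm (k x) \<le> B" if "x \<in> space M" for x
    using tendsto_norm[OF lim[OF that]] assms(2)[OF that]
    by (intro LIMSEQ_le_const2[of "\<lambda>n. norm (h n x)"]) auto
  have "(\<lambda>x. k x * g x) \<in> C" if g: "g \<in> C" for g
  proof (rule closure_dominated)
    show "(\<lambda>x. h n x * g x) \<in> C" for n using assms(1) g by (rule multiplier_closure)
    show wm: "(\<lambda>x. of_real (2 * B) * g x) \<in> borel_measurable M"
      using closure_meas[OF g] by measurable
    show "Ls_int t M (\<lambda>x. of_real (2 * B) * g x) < \<infinity>"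
      using closure_fin[OF g] closure_meas[OF g]
      by (simp add: Ls_int_scale ennreal_mult_less_top)
    show "norm (k x * g x - h n x * g x) \<le> norm (of_real (2 * B) * g x)" if "x \<in> space M" for n x
    proof -
      have "norm (k x - h n x) \<le> norm (k x) + norm (h n x)" by (rule norm_triangle_ineq4)
      also have "\<dots> \<le> \<bar>2 * B\<bar>" using kB assms(2) that by (smt (verit))
      finally have "norm (k x - h n x) * norm (g x) \<le> \<bar>2 * B\<bar> * norm (g x)"
        by (rule mult_right_mono) simp
      then show ?thesis by (simp add: norm_mult flip: left_diff_distrib)
    qed
    show "(\<lambda>n. h n x * g x) \<longlonglongrightarrow> k x * g x" if "x \<in> space M" for x
      using lim[OF that] by (intro tendsto_intros)
  qed
  with km kB show ?thesis by (rule multiplierI)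
qed

text \<open>Functions are defined on the whole type, but only their values on \<open>space M\<close>
  matter. The constant sequence \<open>h\<close> converges to \<open>k\<close> there, so the limit
  lemma absorbs the difference.\<close>

lemma multiplier_cong:
  assumes "h \<in> H" "\<And>x. x \<in> space M \<Longrightarrow> h x = k x"
  shows "k \<in> H"
proof -
  obtain B where B: "\<And>x. x \<in> space M \<Longrightarrow> norm (h x) \<le> B"
    using multiplier_bounded[OF assms(1)] by blast
  show ?thesis
    by (rule multiplier_dominated[where h = "\<lambda>n. h" and B = B]) (simp_all add: assms(1) B flip: assms(2))
qed

lemma multiplier_const: "(\<lambda>x. c) \<in> H"
proof -
  have "(\<lambda>x. c * g x) \<in> C" if g: "g \<in> C" for g
    unfolding Ls_closure_def
  proof (safe)
    show "(\<lambda>x. c * g x) \<in> borel_measurable M" using closure_meas[OF g] by measurable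
    fix e :: real assume e: "0 < e"
    \<comment> \<open>The summand 1 covers \<open>c = 0\<close> and makes the final inequality
      strict.\<close>
    define d where "d = e / (norm c powr t + 1)"
    have d: "0 < d" using e by (simp add: d_def add_nonneg_pos)
    obtain p where p: "p \<in> F" "Ls_int t M (\<lambda>x. g x - p x) < ennreal d"
      using g d unfolding Ls_closure_def by blast
    have "Ls_int t M (\<lambda>x. c * (g x - p x)) = ennreal (norm c powr t) * Ls_int t M (\<lambda>x. g x - p x)"
      using closure_meas[OF g] F_meas[OF p(1)] by (intro Ls_int_scale) measurable
    also have "\<dots> \<le> ennreal (norm c powr t) * ennreal d"
      using p(2) by (intro mult_left_mono) auto
    also have "\<dots> = ennreal (norm c powr t * d)" using d by (simp add: ennreal_mult)
    also have "\<dots> < ennreal e"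
    proof -
      have "norm c powr t * e < e * (norm c powr t + 1)" using e by (simp add: algebra_simps)
      then have "norm c powr t * d < e"
        unfolding d_def by (simp add: add_nonneg_pos divide_less_eq)
      then show ?thesis using e by (simp add: ennreal_lessI)
    qed
    finally have "Ls_int t M (\<lambda>x. c * g x - c * p x) < ennreal e"
      by (simp add: right_diff_distrib)
    then show "\<exists>r\<in>F. Ls_int t M (\<lambda>x. c * g x - r x) < ennreal e"
      using F_scale[OF p(1)] by (intro bexI[of _ "\<lambda>x. c * p x"])
  qed
  then show ?thesis by (intro multiplierI[where B = "norm c"]) auto
qed

lemma multiplier_mult:
  assumes "h \<in> H" "k \<in> H"
  shows "(\<lambda>x. h x * k x) \<in> H"
proof -
  obtain A where A: "\<And>x. x \<in> space M \<Longrightarrow> norm (h x) \<le> A"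
    using multiplier_bounded[OF assms(1)] by blast
  obtain B where B: "\<And>x. x \<in> space M \<Longrightarrow> norm (k x) \<le> B"
    using multiplier_bounded[OF assms(2)] by blast
  have "norm (h x * k x) \<le> A * B" if "x \<in> space M" for x
    unfolding norm_mult using A[OF that] B[OF that]
    by (intro mult_mono) (auto intro: order_trans[OF norm_ge_zero])
  moreover have "(\<lambda>x. (h x * k x) * g x) \<in> C" if "g \<in> C" for g
    using multiplier_closure[OF assms(1) multiplier_closure[OF assms(2) that]]
    by (simp add: mult.assoc)
  moreover have "(\<lambda>x. h x * k x) \<in> borel_measurable M"
    using assms[THEN multiplier_meas] by measurable
  ultimately show ?thesis by (intro multiplierI)
qed

lemma multiplier_add:
  assumes "h \<in> H" "k \<in> H"
  shows "(\<lambda>x. h x + k x) \<in> H"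
proof -
  obtain A where A: "\<And>x. x \<in> space M \<Longrightarrow> norm (h x) \<le> A"
    using multiplier_bounded[OF assms(1)] by blast
  obtain B where B: "\<And>x. x \<in> space M \<Longrightarrow> norm (k x) \<le> B"
    using multiplier_bounded[OF assms(2)] by blast
  have "norm (h x + k x) \<le> A + B" if "x \<in> space M" for x
    using A[OF that] B[OF that] norm_triangle_ineq[of "h x" "k x"] by linarith
  moreover have "(\<lambda>x. (h x + k x) * g x) \<in> C" if "g \<in> C" for g
    using closure_add[OF multiplier_closure[OF assms(1) that] multiplier_closure[OF assms(2) that]]
    by (simp add: distrib_right)
  moreover have "(\<lambda>x. h x + k x) \<in> borel_measurable M"
    using assms[THEN multiplier_meas] by measurable
  ultimately show ?thesis by (intro multiplierI)
qed

lemma multiplier_diff: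
  assumes "h \<in> H" "k \<in> H"
  shows "(\<lambda>x. h x - k x) \<in> H"
  using multiplier_add[OF assms(1) multiplier_mult[OF multiplier_const[of "-1"] assms(2)]] by simp

lemma multiplier_power:
  assumes "h \<in> H"
  shows "(\<lambda>x. h x ^ n) \<in> H"
proof (induction n)
  case 0
  show ?case using multiplier_const[of 1] by simp
next
  case (Suc n)
  show ?case using multiplier_mult[OF assms Suc] by simp
qed

lemma multiplier_sum: "(\<And>i. i \<in> I \<Longrightarrow> h i \<in> H) \<Longrightarrow> (\<lambda>x. \<Sum>i\<in>I. h i x) \<in> H"
proof (induction I rule: infinite_finite_induct)
  case (insert i I)
  show ?case
    using multiplier_add[of "h i" "\<lambda>x. \<Sum>i\<in>I. h i x"] insert by simp
qed (simp_all add: multiplier_const)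

lemma multiplier_prod: "(\<And>i. i \<in> I \<Longrightarrow> h i \<in> H) \<Longrightarrow> (\<lambda>x. \<Prod>i\<in>I. h i x) \<in> H"
proof (induction I rule: infinite_finite_induct)
  case (insert i I)
  show ?case
    using multiplier_mult[of "h i" "\<lambda>x. \<Prod>i\<in>I. h i x"] insert by simp
qed (simp_all add: multiplier_const)

section \<open>From multipliers to indicators of level sets\<close>

text \<open>Bernstein polynomials of \<phi> evaluated at \<open>h\<close> are polynomials in a
  multiplier, hence multipliers, and they converge uniformly on the unit interval. The errors are at
  most 1, so all approximants are bounded by \<open>B + 1\<close>.\<close>

lemma multiplier_continuous:
  fixes h :: "'b \<Rightarrow> real"
  assumes h: "(\<lambda>x. complex_of_real (h x)) \<in> H" "\<And>x. x \<in> space M \<Longrightarrow> h x \<in> {0..1}"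
    and \<phi>: "continuous_on {0..1} \<phi>"
  shows "(\<lambda>x. complex_of_real (\<phi> (h x))) \<in> H"
proof -
  have "\<exists>N. \<forall>x\<in>{0..1}. \<bar>\<phi> x - (\<Sum>k\<le>N. \<phi> (k / N) * Bernstein N k x)\<bar> < inverse (real (Suc n))" for n
  proof -
    have "0 < inverse (real (Suc n))" by simp
    from Bernstein_Weierstrass[OF \<phi> this] show ?thesis by blast
  qed
  then obtain N where N: "\<And>n x. x \<in> {0..1} \<Longrightarrow>
      \<bar>\<phi> x - (\<Sum>k\<le>N n. \<phi> (k / N n) * Bernstein (N n) k x)\<bar> < inverse (real (Suc n))"
    by metis
  define P where "P n x = (\<Sum>k\<le>N n. \<phi> (k / N n) * Bernstein (N n) k x)" for n x
  have "bounded (\<phi> ` {0..1})"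
    using \<phi> by (intro compact_imp_bounded compact_continuous_image) auto
  then have "\<exists>B. \<forall>x\<in>{0..1}. \<bar>\<phi> x\<bar> \<le> B"
    by (simp add: bounded_iff)
  then obtain B where B: "\<And>x. x \<in> {0..1} \<Longrightarrow> \<bar>\<phi> x\<bar> \<le> B" by blast
  show ?thesis
  proof (rule multiplier_dominated)
    have "(\<lambda>x. \<Sum>k\<le>N n. complex_of_real (\<phi> (k / N n)) *
        (of_nat (N n choose k) * complex_of_real (h x) ^ k * (1 - complex_of_real (h x)) ^ (N n - k))) \<in> H"
      for n
      by (intro multiplier_sum multiplier_mult multiplier_const multiplier_power multiplier_diff h)
    then show "(\<lambda>x. complex_of_real (P n (h x))) \<in> H" for n
      by (simp add: P_def Bernstein_def)
    show "norm (complex_of_real (P n (h x))) \<le> B + 1" if "x \<in> space M" for n x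
    proof -
      have "\<bar>\<phi> (h x) - P n (h x)\<bar> < inverse (real (Suc n))"
        unfolding P_def using h(2)[OF that] by (rule N)
      moreover have "inverse (real (Suc n)) \<le> 1" by (simp add: field_simps)
      ultimately show ?thesis using B[OF h(2)[OF that]] unfolding norm_of_real by linarith
    qed
    show "(\<lambda>n. complex_of_real (P n (h x))) \<longlonglongrightarrow> complex_of_real (\<phi> (h x))" if "x \<in> space M" for x
    proof -
      have "(\<lambda>n. \<phi> (h x) - P n (h x)) \<longlonglongrightarrow> 0"
      proof (rule Lim_null_comparison[OF _ LIMSEQ_inverse_real_of_nat])
        show "\<forall>\<^sub>F n in sequentially. norm (\<phi> (h x) - P n (h x)) \<le> inverse (real (Suc n))"
          using N[OF h(2)[OF that]] unfolding P_def by (auto intro!: always_eventually less_imp_le)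
      qed
      from tendsto_diff[OF tendsto_const[of "\<phi> (h x)"] this]
      show ?thesis by (intro tendsto_of_real) simp
    qed
  qed
qed

text \<open>The ramps \<open>min 1 (n * max 0 (h - a))\<close> are continuous functions of
  \<open>h\<close> with values in the unit interval. They vanish where \<open>h\<close> is at most
  \<open>a\<close> and are eventually 1 where \<open>h\<close> exceeds \<open>a\<close>.\<close>

lemma multiplier_indicator_greater:
  fixes h :: "'b \<Rightarrow> real"
  assumes h: "(\<lambda>x. complex_of_real (h x)) \<in> H" "\<And>x. x \<in> space M \<Longrightarrow> h x \<in> {0..1}"
  shows "(\<lambda>x. indicator {x \<in> space M. a < h x} x) \<in> H"
proof (rule multiplier_dominated)
  show "(\<lambda>x. complex_of_real (min 1 (real n * max 0 (h x - a)))) \<in> H" for n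
    by (intro multiplier_continuous[OF h] continuous_intros)
  show "norm (complex_of_real (min 1 (real n * max 0 (h x - a)))) \<le> 1" for n x
    unfolding norm_of_real by (auto simp: abs_if min_def mult_less_0_iff)
  show "(\<lambda>n. complex_of_real (min 1 (real n * max 0 (h x - a))))
      \<longlonglongrightarrow> indicator {x \<in> space M. a < h x} x" if "x \<in> space M" for x
  proof (cases "a < h x")
    case True
    obtain N where "1 < real N * (h x - a)"
      using True reals_Archimedean3[of "h x - a"] by auto
    then have "1 \<le> real n * (h x - a)" if "N \<le> n" for n
      using True that by (smt (verit) mult_right_mono of_nat_le_iff)
    then have "\<forall>\<^sub>F n in sequentially. complex_of_real (min 1 (real n * max 0 (h x - a))) = 1"
      using True by (auto simp: eventually_sequentially intro!: exI[of _ N])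
    then show ?thesis using True that by (simp add: tendsto_eventually)
  qed (use that in simp)
qed

section \<open>The sigma-algebra of sets with multiplier indicator\<close>

definition multiplier_sets :: "'b set set" where
  "multiplier_sets = {E \<in> sets M. (\<lambda>x. indicator E x) \<in> H}"

lemma sigma_algebra_multiplier_sets: "sigma_algebra (space M) multiplier_sets"
  unfolding sigma_algebra_iff2
proof (intro conjI ballI allI impI)
  show "multiplier_sets \<subseteq> Pow (space M)"
    using sets.sets_into_space by (auto simp: multiplier_sets_def)
  show "{} \<in> multiplier_sets"
    using multiplier_cong[OF multiplier_const[of 0], of "indicator {}"]
    by (simp add: multiplier_sets_def)
  show "space M - E \<in> multiplier_sets" if E: "E \<in> multiplier_sets" for E
  proof -
    have "(\<lambda>x. 1 - indicator E x) \<in> H"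
      using E by (intro multiplier_diff multiplier_const) (simp add: multiplier_sets_def)
    then have "(\<lambda>x. indicator (space M - E) x) \<in> H"
      by (rule multiplier_cong) (auto simp: indicator_def)
    then show ?thesis using E by (auto simp: multiplier_sets_def)
  qed
  show "(\<Union>i. A i) \<in> multiplier_sets" if A: "range A \<subseteq> multiplier_sets" for A :: "nat \<Rightarrow> 'b set"
  proof -
    have "(\<lambda>x. indicator (\<Union>i. A i) x) \<in> H"
    proof (rule multiplier_dominated)
      \<comment> \<open>De Morgan writes the indicator of a finite, possibly overlapping union with
        algebra operations alone; the countable union is the bounded limit of these.\<close>
      have eq: "1 - (\<Prod>i<n. 1 - indicator (A i) x) = (indicator (\<Union>i<n. A i) x :: complex)" for n x
        by (auto simp: indicator_def prod_zero_iff)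
      have "(\<lambda>x. 1 - (\<Prod>i<n. 1 - indicator (A i) x)) \<in> H" for n
        using A by (intro multiplier_diff multiplier_const multiplier_prod)
          (auto simp: multiplier_sets_def)
      then show "(\<lambda>x. indicator (\<Union>i<n. A i) x) \<in> H" for n by (simp only: eq)
      show "norm (indicator (\<Union>i<n. A i) x :: complex) \<le> 1" for n x
        by (simp add: indicator_def)
      show "(\<lambda>n. indicator (\<Union>i<n. A i) x :: complex) \<longlonglongrightarrow> indicator (\<Union>i. A i) x" for x
        by (rule LIMSEQ_indicator_UN)
    qed
    then show ?thesis using A by (auto simp: multiplier_sets_def)
  qed
qed

lemma borel_measurable_multiplier_sets:
  fixes h :: "'b \<Rightarrow> real"
  assumes "(\<lambda>x. complex_of_real (h x)) \<in> H" "\<And>x. x \<in> space M \<Longrightarrow> h x \<in> {0..1}"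
    and hm: "h \<in> borel_measurable M"
  shows "h \<in> borel_measurable (sigma (space M) multiplier_sets)"
  unfolding borel_measurable_iff_greater
proof
  interpret S: sigma_algebra "space M" multiplier_sets by (rule sigma_algebra_multiplier_sets)
  fix a
  have "(\<lambda>x. indicator {x \<in> space M. a < h x} x) \<in> H"
    using assms(1,2) by (rule multiplier_indicator_greater)
  moreover have "{x \<in> space M. a < h x} \<in> sets M" using hm by measurable
  ultimately show "{x \<in> space (sigma (space M) multiplier_sets). a < h x}
      \<in> sets (sigma (space M) multiplier_sets)"
    using S.space_closed by (simp add: S.sigma_sets_eq multiplier_sets_def)
qed

text \<open>Simple functions are linear combinations of multiplier indicators, hence multipliers,
  hence in \<open>C\<close>; dominated approximation by simple functions then reaches
  \<open>f\<close>.\<close>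

lemma closure_eq_Ls:
  assumes "sets M \<subseteq> multiplier_sets" "f \<in> borel_measurable M" "Ls_int t M f < \<infinity>"
  shows "f \<in> C"
proof -
  obtain s where s: "\<And>i. simple_function M (s i)"
      "\<And>x. x \<in> space M \<Longrightarrow> (\<lambda>i. s i x) \<longlonglongrightarrow> f x"
      "\<And>i x. x \<in> space M \<Longrightarrow> norm (s i x) \<le> 2 * norm (f x)"
    using borel_measurable_implies_sequence_metric[OF assms(2), of 0]
    unfolding dist_0_norm dist_norm diff_zero by blast
  show ?thesis
  proof (rule closure_dominated)
    show "s i \<in> C" for i
    proof (rule multiplier_in_closure, rule multiplier_cong)
      show "(\<lambda>x. \<Sum>y\<in>s i ` space M. indicator (s i -` {y} \<inter> space M) x * y) \<in> H"
        using s(1)[of i] assms(1)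
        by (intro multiplier_sum multiplier_mult multiplier_const)
          (auto simp: simple_function_def multiplier_sets_def)
      show "(\<Sum>y\<in>s i ` space M. indicator (s i -` {y} \<inter> space M) x * y) = s i x" if "x \<in> space M" for x
      proof -
        have eq: "indicator A x * y = indicator A x *\<^sub>R y" for A and y :: complex
          by (simp add: indicator_def)
        show ?thesis
          by (simp only: eq simple_function_indicator_representation_banach[OF s(1) that, symmetric])
      qed
    qed
    \<comment> \<open>The factor is 3 because \<open>norm (s i x)\<close> is at most
      \<open>2 * norm (f x)\<close>.\<close>
    show "(\<lambda>x. 3 * f x) \<in> borel_measurable M" using assms(2) by measurable
    show "Ls_int t M (\<lambda>x. 3 * f x) < \<infinity>"
      using assms(2,3) by (simp add: Ls_int_scale ennreal_mult_less_top)
    show "norm (f x - s i x) \<le> norm (3 * f x)" if "x \<in> space M" for i x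
      using norm_triangle_ineq4[of "f x" "s i x"] s(3)[OF that, of i] by (simp add: norm_mult)
    show "(\<lambda>i. s i x) \<longlonglongrightarrow> f x" if "x \<in> space M" for x using s(2) that .
  qed
qed

section \<open>Bounded L^s limits as multipliers\<close>

text \<open>The error splits as \<open>f g - p q = f (g - p) + p (f - q)\<close>. First
  \<open>p\<close> approximates \<open>g\<close> in L^t, where \<open>f\<close> bounded by 1 does no
  harm; only then is \<open>q\<close> taken so close to \<open>f\<close> in L^s that the factor
  \<open>p\<close> is harmless too.\<close>

lemma multiplier_of_closure:
  assumes "t < s" "f \<in> Ls_closure s M F" "\<And>x. x \<in> space M \<Longrightarrow> norm (f x) \<le> 1"
    and F_mult: "\<And>p q. p \<in> F \<Longrightarrow> q \<in> F \<Longrightarrow> (\<lambda>x. p x * q x) \<in> F"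
    and F_fin': "\<And>p. p \<in> F \<Longrightarrow> Ls_int (s * t / (s - t)) M p < \<infinity>"
  shows "f \<in> H"
proof (rule multiplierI)
  show fm: "f \<in> borel_measurable M" using assms(2) by (simp add: Ls_closure_def)
  show "norm (f x) \<le> 1" if "x \<in> space M" for x using that by (rule assms(3))
  fix g assume g: "g \<in> C"
  note gm = closure_meas[OF g]
  show "(\<lambda>x. f x * g x) \<in> C"
    unfolding Ls_closure_def
  proof (intro CollectI conjI allI impI)
    show "(\<lambda>x. f x * g x) \<in> borel_measurable M" using fm gm by measurable
    fix e :: real assume e: "0 < e"
    define d where "d = e / (2 * 2 powr t)"
    have d: "0 < d" using e by (simp add: d_def)
    obtain p where p: "p \<in> F" "Ls_int t M (\<lambda>x. g x - p x) < ennreal d"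
      using closure_approx[OF g d] by blast
    note pm = F_meas[OF p(1)]
    obtain d' where d': "0 < d'" and small: "\<And>u. u \<in> borel_measurable M \<Longrightarrow>
        Ls_int s M u < ennreal d' \<Longrightarrow> Ls_int t M (\<lambda>x. p x * u x) < ennreal d"
      using Ls_int_mult_small[OF t_pos assms(1) d pm F_fin'[OF p(1)]] by blast
    obtain q where q: "q \<in> F" "Ls_int s M (\<lambda>x. f x - q x) < ennreal d'"
      using assms(2) d' unfolding Ls_closure_def by blast
    note qm = F_meas[OF q(1)]
    have "Ls_int t M (\<lambda>x. f x * (g x - p x)) \<le> Ls_int t M (\<lambda>x. g x - p x)"
      using t_pos assms(3) by (intro Ls_int_mono) (auto simp: norm_mult intro: mult_left_le_one_le)
    then have 1: "Ls_int t M (\<lambda>x. f x * (g x - p x)) < ennreal d"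
      using p(2) by (rule le_less_trans)
    have 2: "Ls_int t M (\<lambda>x. p x * (f x - q x)) < ennreal d"
      using fm qm q(2) by (intro small) measurable
    have "Ls_int t M (\<lambda>x. f x * (g x - p x) + p x * (f x - q x)) < ennreal e"
    proof (rule Ls_int_add_less[OF t_pos _ _ e 1[unfolded d_def] 2[unfolded d_def]])
      show "(\<lambda>x. f x * (g x - p x)) \<in> borel_measurable M" using fm gm pm by measurable
      show "(\<lambda>x. p x * (f x - q x)) \<in> borel_measurable M" using fm pm qm by measurable
    qed
    moreover have "f x * (g x - p x) + p x * (f x - q x) = f x * g x - p x * q x" for x
      by (simp add: algebra_simps)
    ultimately have "Ls_int t M (\<lambda>x. f x * g x - p x * q x) < ennreal e" by simp
    then show "\<exists>r\<in>F. Ls_int t M (\<lambda>x. f x * g x - r x) < ennreal e"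
      using F_mult[OF p(1) q(1)] by (rule bexI[where x = "\<lambda>x. p x * q x"])
  qed
qed

end

section \<open>Polynomial functions\<close>

text \<open>The moment hypothesis speaks of monomials only; this makes it cover their
  powers.\<close>

lemma monomial_power_exists:
  "\<exists>m'. Poly_Mapping.keys m' \<subseteq> Poly_Mapping.keys m \<and>
     (\<forall>x :: 'i \<Rightarrow> real. poly_eval x (Poly_Mapping.single m' 1) = poly_eval x (Poly_Mapping.single m 1) ^ k)"
proof (induction k)
  case 0
  show ?case by (intro exI[of _ 0]) simp
next
  case (Suc k)
  then obtain m' where m': "Poly_Mapping.keys m' \<subseteq> Poly_Mapping.keys m"
    "\<And>x :: 'i \<Rightarrow> real. poly_eval x (Poly_Mapping.single m' 1) = poly_eval x (Poly_Mapping.single m 1) ^ k"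
    by blast
  have "poly_eval x (Poly_Mapping.single (m + m') 1) =
      poly_eval x (Poly_Mapping.single m 1) ^ Suc k" for x :: "'i \<Rightarrow> real"
    using poly_eval_mult[of x "Poly_Mapping.single m 1" "Poly_Mapping.single m' 1"]
    by (simp add: mult_single m'(2))
  then show ?case using m'(1) by (intro exI[of _ "m + m'"]) (auto simp: keys_add_nat)
qed

lemma cpoly_fun_0: "cpoly_fun 0 = (\<lambda>x. 0)"
  by (simp add: cpoly_fun_def fun_eq_iff)

lemma cpoly_fun_add: "cpoly_fun (p + q) = (\<lambda>x. cpoly_fun p x + cpoly_fun q x)"
  by (simp add: cpoly_fun_def poly_eval_add fun_eq_iff)

lemma cpoly_fun_mult: "cpoly_fun (p * q) = (\<lambda>x. cpoly_fun p x * cpoly_fun q x)"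
  by (simp add: cpoly_fun_def poly_eval_mult fun_eq_iff)

lemma cpoly_fun_single:
  "cpoly_fun (Poly_Mapping.single m c) =
     (\<lambda>x. c * complex_of_real (poly_eval x (Poly_Mapping.single m 1)))"
  by (simp add: cpoly_fun_def poly_eval_single fun_eq_iff)

text \<open>Each step adds a new monomial, so nothing cancels and every intermediate sum stays in
  \<open>polys \<Omega>\<close>.\<close>

lemma polys_induct [consumes 1, case_names zero add]:
  assumes "p \<in> polys \<Omega>" "P 0"
    and "\<And>p m c. Poly_Mapping.keys m \<subseteq> \<Omega> \<Longrightarrow> p \<in> polys \<Omega> \<Longrightarrow> P p \<Longrightarrow> P (p + Poly_Mapping.single m c)"
  shows "P (p :: ('i, 'a::comm_monoid_add) mpoly)"
  using assms(1)
proof (induction p rule: poly_mapping_induct)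
  case zero
  show ?case by (rule assms(2))
next
  case (add p m c)
  have "Poly_Mapping.keys (p + Poly_Mapping.single m c) = insert m (Poly_Mapping.keys p)"
    using add.hyps by (auto simp: in_keys_iff lookup_add lookup_single when_def split: if_splits)
  with add.prems have "p \<in> polys \<Omega>" "Poly_Mapping.keys m \<subseteq> \<Omega>"
    by (auto simp: polys_def)
  with add.IH show ?case by (intro assms(3))
qed

text \<open>The variables take real values, so conjugating the coefficients conjugates the
  function.\<close>

lemma cpoly_fun_cnj_exists:
  assumes "p \<in> polys \<Omega>"
  shows "\<exists>q\<in>polys \<Omega>. cpoly_fun q = (\<lambda>x. cnj (cpoly_fun p x))"
  using assms
proof (induction p rule: polys_induct)
  case zero
  show ?case by (intro bexI[of _ 0]) (simp_all add: cpoly_fun_0 polys_def)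
next
  case (add p m c)
  then obtain q where "q \<in> polys \<Omega>" "cpoly_fun q = (\<lambda>x. cnj (cpoly_fun p x))" by blast
  then show ?case
    using add(1) by (intro bexI[of _ "q + Poly_Mapping.single m (cnj c)"] polys_add single_in_polys)
      (simp_all add: cpoly_fun_add cpoly_fun_single)
qed

lemma Ls_closure_cnj:
  assumes "f \<in> Ls_closure s M F" and F_cnj: "\<And>p. p \<in> F \<Longrightarrow> (\<lambda>x. cnj (p x)) \<in> F"
  shows "(\<lambda>x. cnj (f x)) \<in> Ls_closure s M F"
  unfolding Ls_closure_def
proof (intro CollectI conjI allI impI)
  have "f \<in> borel_measurable M" using assms(1) by (simp add: Ls_closure_def)
  then show "(\<lambda>x. cnj (f x)) \<in> borel_measurable M"
    by (intro borel_measurable_continuous_on[where f = cnj] continuous_intros)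
  fix e :: real assume "0 < e"
  then obtain p where p: "p \<in> F" "Ls_int s M (\<lambda>x. f x - p x) < ennreal e"
    using assms(1) unfolding Ls_closure_def by blast
  have "Ls_int s M (\<lambda>x. cnj (f x) - cnj (p x)) = Ls_int s M (\<lambda>x. f x - p x)"
    by (intro Ls_int_cong) (simp flip: complex_cnj_diff)
  with p(2) have "Ls_int s M (\<lambda>x. cnj (f x) - cnj (p x)) < ennreal e" by simp
  then show "\<exists>q\<in>F. Ls_int s M (\<lambda>x. cnj (f x) - q x) < ennreal e"
    using F_cnj[OF p(1)] by (rule bexI[where x = "\<lambda>x. cnj (p x)"])
qed

section \<open>Absolute moments of polynomial functions\<close>

lemma moments_cpoly_fun:
  assumes mom: "\<And>m. Poly_Mapping.keys m \<subseteq> \<Omega> \<Longrightarrow>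
      integrable \<nu> (\<lambda>x. poly_eval x (Poly_Mapping.single m (1::real)))"
    and "p \<in> polys \<Omega>" "0 < t"
  shows "cpoly_fun p \<in> borel_measurable \<nu>" "Ls_int t \<nu> (cpoly_fun p) < \<infinity>"
proof -
  have "cpoly_fun p \<in> borel_measurable \<nu> \<and> Ls_int t \<nu> (cpoly_fun p) < \<infinity>"
    using assms(2)
  proof (induction p rule: polys_induct)
    case zero
    show ?case using assms(3) by (simp add: cpoly_fun_0 Ls_int_def)
  next
    case (add p m c)
    let ?f = "\<lambda>x. poly_eval x (Poly_Mapping.single m (1::real))"
    let ?g = "\<lambda>x. complex_of_real (?f x)"
    have fm: "?f \<in> borel_measurable \<nu>"
      using mom[OF add(1)] by (rule borel_measurable_integrable)
    then have gm: "?g \<in> borel_measurable \<nu>" by measurable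
    \<comment> \<open>An even exponent above \<open>t\<close> gives
      \<open>|f|^t \<le> 1 + f^k\<close>, whose right side involves no absolute value and is a sum
      of two monomials.\<close>
    define k where "k = 2 * nat \<lceil>t\<rceil>"
    have k: "t \<le> real k" "even k"
      using real_nat_ceiling_ge[of t] unfolding k_def by linarith simp
    have "integrable \<nu> (\<lambda>x. ?f x ^ k)"
    proof -
      obtain m' where m': "Poly_Mapping.keys m' \<subseteq> Poly_Mapping.keys m"
        "\<forall>x. poly_eval x (Poly_Mapping.single m' 1) = ?f x ^ k"
        using monomial_power_exists[of m k] by (elim exE conjE)
      show ?thesis
        using mom[OF order_trans[OF m'(1) add(1)]] unfolding m'(2)[rule_format] .
    qed
    moreover have "integrable \<nu> (\<lambda>x. 1 :: real)"
      using mom[of 0] by simp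
    ultimately have "integrable \<nu> (\<lambda>x. 1 + ?f x ^ k)"
      by (rule Bochner_Integration.integrable_add[rotated])
    then have int: "(\<integral>\<^sup>+ x. ennreal (1 + ?f x ^ k) \<partial>\<nu>) = ennreal (\<integral>x. 1 + ?f x ^ k \<partial>\<nu>)"
      using k(2) by (intro nn_integral_eq_integral) (auto intro!: AE_I2 add_nonneg_nonneg)
    have "Ls_int t \<nu> ?g \<le> (\<integral>\<^sup>+ x. ennreal (1 + ?f x ^ k) \<partial>\<nu>)"
      unfolding Ls_int_def
    proof (intro nn_integral_mono ennreal_leI)
      fix x
      have "\<bar>?f x\<bar> powr t \<le> 1 + \<bar>?f x\<bar> ^ k"
      proof (cases "\<bar>?f x\<bar> \<le> 1")
        case True
        then have "\<bar>?f x\<bar> powr t \<le> 1" using assms(3) by (intro powr_le1) auto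
        then show ?thesis by (simp add: add_increasing2)
      next
        case False
        then have "\<bar>?f x\<bar> powr t \<le> \<bar>?f x\<bar> powr real k" using k(1) by (intro powr_mono) auto
        also have "\<dots> = \<bar>?f x\<bar> ^ k" using False by (intro powr_realpow) linarith
        finally show ?thesis by simp
      qed
      then show "norm (?g x) powr t \<le> 1 + ?f x ^ k"
        using k(2) by (simp add: power_even_abs)
    qed
    also have "\<dots> < \<infinity>" unfolding int by simp
    finally have gfin: "Ls_int t \<nu> ?g < \<infinity>" .
    from add(3) have pm: "cpoly_fun p \<in> borel_measurable \<nu>"
      and pfin: "Ls_int t \<nu> (cpoly_fun p) < \<infinity>" by blast+
    have cgm: "(\<lambda>x. c * ?g x) \<in> borel_measurable \<nu>" using gm by measurable
    have "Ls_int t \<nu> (\<lambda>x. cpoly_fun p x + c * ?g x) \<le>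
        ennreal (2 powr t) * (Ls_int t \<nu> (cpoly_fun p) + Ls_int t \<nu> (\<lambda>x. c * ?g x))"
      using assms(3) pm cgm by (rule Ls_int_add_le)
    also have "\<dots> < \<infinity>"
      using pfin gfin gm by (simp add: Ls_int_scale ennreal_mult_less_top)
    finally show ?case
      using pm cgm by (simp add: cpoly_fun_add cpoly_fun_single)
  qed
  then show "cpoly_fun p \<in> borel_measurable \<nu>" "Ls_int t \<nu> (cpoly_fun p) < \<infinity>" by auto
qed

section \<open>Measurable sets generated by the coordinates\<close>

lemma poly_eval_measurable:
  assumes "\<And>j. j \<in> \<Omega> \<Longrightarrow> (\<lambda>x. x j) \<in> borel_measurable N" "p \<in> polys \<Omega>"
  shows "(\<lambda>x. poly_eval x p :: real) \<in> borel_measurable N"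
  unfolding poly_eval_def
proof (intro borel_measurable_sum borel_measurable_times borel_measurable_const
    borel_measurable_prod borel_measurable_power)
  show "(\<lambda>x. x j) \<in> borel_measurable N"
    if "m \<in> Poly_Mapping.keys p" "j \<in> Poly_Mapping.keys m" for m j
    using assms(2) that by (intro assms(1)) (auto simp: polys_def)
qed

text \<open>Under point evaluation each generator pulls back to the set where one polynomial is
  positive, and polynomials are measurable as soon as the coordinates are.\<close>

lemma sets_vimage_constructible_borel_subset:
  assumes "sigma_algebra (real_power \<Omega>) \<Sigma>"
    and "\<And>j. j \<in> \<Omega> \<Longrightarrow> (\<lambda>x. x j) \<in> borel_measurable (sigma (real_power \<Omega>) \<Sigma>)"
  shows "sets (vimage_algebra (real_power \<Omega>) (point_eval \<Omega>) (constructible_borel (polys \<Omega>))) \<subseteq> \<Sigma>"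
proof -
  interpret sigma_algebra "real_power \<Omega>" \<Sigma> by fact
  let ?N = "sigma (real_power \<Omega>) \<Sigma>"
  have N: "sets ?N = \<Sigma>" "space ?N = real_power \<Omega>"
    using space_closed by (simp_all add: sigma_sets_eq)
  have "sets (vimage_algebra (real_power \<Omega>) (point_eval \<Omega>) (constructible_borel (polys \<Omega>))) =
      sigma_sets (real_power \<Omega>) {point_eval \<Omega> -` A \<inter> real_power \<Omega> |A.
        A \<in> {{\<alpha> \<in> characters (polys \<Omega>). 0 < \<alpha> a} |a. a \<in> polys \<Omega>}}"
    unfolding constructible_borel_def
    using bij_betw_imp_surj_on[OF bij_betw_point_eval]
    by (subst vimage_algebra_sigma) (auto intro!: sets_measure_of)
  also have "\<dots> \<subseteq> \<Sigma>"
  proof (rule sigma_sets_subset, safe)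
    fix a :: "('a, real) mpoly" assume a: "a \<in> polys \<Omega>"
    have "point_eval \<Omega> -` {\<alpha> \<in> characters (polys \<Omega>). 0 < \<alpha> a} \<inter> real_power \<Omega> =
        {x \<in> space ?N. 0 < poly_eval x a}"
      using bij_betw_imp_surj_on[OF bij_betw_point_eval[of \<Omega>]] a
      unfolding N(2) by (auto simp: point_eval_def)
    also have "\<dots> \<in> sets ?N"
      using poly_eval_measurable[OF assms(2) a] by measurable
    finally show "point_eval \<Omega> -` {\<alpha> \<in> characters (polys \<Omega>). 0 < \<alpha> a} \<inter> real_power \<Omega> \<in> \<Sigma>"
      unfolding N(1) .
  qed
  finally show ?thesis .
qed

text \<open>The two functions are the real part, shifted by 1/2, and the imaginary part of
  \<open>1 / (y - \<i>)\<close>; \<open>y\<close> is the quotient of these parts. The shift brings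
  the real part into the unit interval, as Bernstein approximation requires.\<close>

lemma borel_measurable_of_resolvent_parts:
  fixes y :: "'b \<Rightarrow> real"
  assumes "(\<lambda>x. y x / (y x ^ 2 + 1) + 1 / 2) \<in> borel_measurable N"
    and "(\<lambda>x. 1 / (y x ^ 2 + 1)) \<in> borel_measurable N"
  shows "y \<in> borel_measurable N"
proof -
  have "(\<lambda>x. (y x / (y x ^ 2 + 1) + 1 / 2 - 1 / 2) / (1 / (y x ^ 2 + 1))) \<in> borel_measurable N"
    by (rule borel_measurable_divide[OF borel_measurable_diff[OF assms(1) borel_measurable_const] assms(2)])
  moreover have "(y x / (y x ^ 2 + 1) + 1 / 2 - 1 / 2) / (1 / (y x ^ 2 + 1)) = y x" for x
  proof -
    have "y x ^ 2 + 1 \<noteq> 0" using zero_le_power2[of "y x"] by linarith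
    then show ?thesis by simp
  qed
  ultimately show ?thesis by simp
qed

lemma one_divide_complex_minus_i:
  "1 / (complex_of_real y - \<i>) = Complex (y / (y\<^sup>2 + 1)) (1 / (y\<^sup>2 + 1))"
proof -
  have "complex_of_real y - \<i> = Complex y (-1)"
    by (simp add: complex_eq_iff)
  then show ?thesis by (simp add: complex_eq_iff Re_divide Im_divide)
qed

section \<open>Density of the polynomials\<close>

theorem proposition4p3:
  fixes \<Omega> :: "'i set" and \<nu> :: "('i \<Rightarrow> real) measure" and s :: real
  assumes "constructibly_radon_on_power \<Omega> \<nu>"
    and "1 < s"
    and "\<forall>j\<in>\<Omega>. \<exists>q :: nat \<Rightarrow> ('i, complex) mpoly. (\<forall>k. q k \<in> polys \<Omega>) \<and>
      (\<lambda>k. Ls_norm s \<nu> (\<lambda>x. cpoly_fun (q k) x - 1 / (complex_of_real (x j) - \<i>)))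
        \<longlonglongrightarrow> 0"
  shows "\<forall>s'. 1 \<le> s' \<and> s' < s \<longrightarrow> dense_in_Ls (cpoly_fun ` polys \<Omega>) s' \<nu>"
proof (intro allI impI, elim conjE)
  fix t :: real assume t: "1 \<le> t" "t < s"
  define F where "F = (cpoly_fun ` polys \<Omega> :: (('i \<Rightarrow> real) \<Rightarrow> complex) set)"
  have space: "space \<nu> = real_power \<Omega>"
    and sets: "sets \<nu> = sets (vimage_algebra (real_power \<Omega>) (point_eval \<Omega>)
      (constructible_borel (polys \<Omega>)))"
    and mom: "\<And>m. Poly_Mapping.keys m \<subseteq> \<Omega> \<Longrightarrow>
      integrable \<nu> (\<lambda>x. poly_eval x (Poly_Mapping.single m (1::real)))"
    using assms(1) unfolding constructibly_radon_on_power_def by blast+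
  have F_measurable: "f \<in> borel_measurable \<nu>" if "f \<in> F" for f
    using that moments_cpoly_fun(1)[OF mom _ zero_less_one] unfolding F_def by blast
  have F_moments: "Ls_int r \<nu> f < \<infinity>" if "f \<in> F" "0 < r" for f r
    using that(1) moments_cpoly_fun(2)[OF mom _ that(2)] unfolding F_def by blast
  have F_mult: "(\<lambda>x. f x * g x) \<in> F" if fg: "f \<in> F" "g \<in> F" for f g
  proof -
    obtain p q where "p \<in> polys \<Omega>" "f = cpoly_fun p" "q \<in> polys \<Omega>" "g = cpoly_fun q"
      using fg unfolding F_def by blast
    then show ?thesis
      unfolding F_def by (intro image_eqI[of _ _ "p * q"]) (simp_all add: cpoly_fun_mult polys_mult)
  qed
  have F_cnj: "(\<lambda>x. cnj (f x)) \<in> F" if f: "f \<in> F" for f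
  proof -
    obtain p where p: "p \<in> polys \<Omega>" "f = cpoly_fun p" using f unfolding F_def by blast
    obtain q where q: "q \<in> polys \<Omega>" "cpoly_fun q = (\<lambda>x. cnj (cpoly_fun p x))"
      using cpoly_fun_cnj_exists[OF p(1)] by blast
    show ?thesis unfolding F_def p(2) q(2)[symmetric] using q(1) by (rule imageI)
  qed
  interpret Ls_subspace \<nu> t F
  proof
    show "0 < t" using t by simp
    then show "Ls_int t \<nu> f < \<infinity>" if "f \<in> F" for f using that by (intro F_moments)
    show "f \<in> borel_measurable \<nu>" if "f \<in> F" for f using that by (rule F_measurable)
    show "(\<lambda>x. f x + g x) \<in> F" if fg: "f \<in> F" "g \<in> F" for f g
    proof -
      obtain p q where "p \<in> polys \<Omega>" "f = cpoly_fun p" "q \<in> polys \<Omega>" "g = cpoly_fun q"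
        using fg unfolding F_def by blast
      then show ?thesis
        unfolding F_def by (intro image_eqI[of _ _ "p + q"]) (simp_all add: cpoly_fun_add polys_add)
    qed
    have const: "(\<lambda>x. c) \<in> F" for c
      unfolding F_def
      by (rule image_eqI[of _ _ "Poly_Mapping.single 0 c"]) (simp_all add: cpoly_fun_single single_in_polys)
    then show "(\<lambda>x. 1) \<in> F" .
    show "(\<lambda>x. c * f x) \<in> F" if "f \<in> F" for f c
      using const that by (rule F_mult)
  qed
  \<comment> \<open>A coordinate is a monomial of degree one, hence integrable and in particular
    measurable.\<close>
  have xm: "(\<lambda>x. x j) \<in> borel_measurable \<nu>" if "j \<in> \<Omega>" for j
    using borel_measurable_integrable[OF mom[of "Poly_Mapping.single j 1"]] that
    by (simp add: poly_eval_single)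
  let ?f = "\<lambda>j x. 1 / (complex_of_real (x j) - \<i>)"
  have norm_f: "norm (?f j x) \<le> 1" for j and x :: "'i \<Rightarrow> real"
    using abs_Im_le_cmod[of "complex_of_real (x j) - \<i>"] by (simp add: norm_divide divide_le_eq)
  have f_closure: "?f j \<in> Ls_closure s \<nu> F" if j: "j \<in> \<Omega>" for j
    unfolding Ls_closure_def
  proof (intro CollectI conjI allI impI)
    show "?f j \<in> borel_measurable \<nu>" using xm[OF j] by measurable
    fix e :: real assume e: "0 < e"
    obtain q :: "nat \<Rightarrow> ('i, complex) mpoly" where q: "\<And>k. q k \<in> polys \<Omega>"
      "(\<lambda>k. Ls_norm s \<nu> (\<lambda>x. cpoly_fun (q k) x - ?f j x)) \<longlonglongrightarrow> 0"
      using assms(3) j by blast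
    \<comment> \<open>The bound \<open>e powr (1 / s)\<close> on the norm amounts to the bound
      \<open>e\<close> on the \<open>s\<close>-th moment.\<close>
    have "\<forall>\<^sub>F k in sequentially. Ls_norm s \<nu> (\<lambda>x. cpoly_fun (q k) x - ?f j x) < ennreal (e powr (1 / s))"
      using order_tendstoD(2)[OF q(2)] e by simp
    then obtain k where "Ls_norm s \<nu> (\<lambda>x. cpoly_fun (q k) x - ?f j x) < ennreal (e powr (1 / s))"
      by (meson eventually_happens trivial_limit_sequentially)
    then have "Ls_int s \<nu> (\<lambda>x. cpoly_fun (q k) x - ?f j x) < ennreal e"
      using assms(2) e by (simp add: Ls_norm_less_iff powr_powr)
    then have "Ls_int s \<nu> (\<lambda>x. ?f j x - cpoly_fun (q k) x) < ennreal e"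
      by (subst Ls_int_minus_commute)
    then show "\<exists>g\<in>F. Ls_int s \<nu> (\<lambda>x. ?f j x - g x) < ennreal e"
      using q(1)[of k] unfolding F_def by blast
  qed
  have exponent: "0 < s * t / (s - t)" using t by simp
  have f_mult: "?f j \<in> H" if "j \<in> \<Omega>" for j
    using t(2) f_closure[OF that] norm_f F_mult F_moments[OF _ exponent] by (rule multiplier_of_closure)
  have cnj_mult: "(\<lambda>x. cnj (?f j x)) \<in> H" if "j \<in> \<Omega>" for j
  proof (rule multiplier_of_closure[OF t(2)])
    show "(\<lambda>x. p x * q x) \<in> F" if "p \<in> F" "q \<in> F" for p q using that by (rule F_mult)
    show "Ls_int (s * t / (s - t)) \<nu> p < \<infinity>" if "p \<in> F" for p
      using that exponent by (rule F_moments)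
    show "(\<lambda>x. cnj (?f j x)) \<in> Ls_closure s \<nu> F"
      using f_closure[OF that] F_cnj by (rule Ls_closure_cnj)
    show "norm (cnj (?f j x)) \<le> 1" for x :: "'i \<Rightarrow> real"
      unfolding complex_mod_cnj by (rule norm_f)
  qed
  have coord: "(\<lambda>x. x j) \<in> borel_measurable (sigma (space \<nu>) multiplier_sets)" if j: "j \<in> \<Omega>" for j
  proof (rule borel_measurable_of_resolvent_parts; rule borel_measurable_multiplier_sets)
    have pos: "0 < y\<^sup>2 + 1" for y :: real using zero_le_power2[of y] by linarith
    \<comment> \<open>Real and imaginary parts are complex linear combinations of the resolvent and
      its conjugate, which is why both had to be multipliers.\<close>
    have "(\<lambda>x. 1 / 2 * (?f j x + cnj (?f j x)) + 1 / 2) \<in> H"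
      using f_mult[OF j] cnj_mult[OF j] by (intro multiplier_add multiplier_mult multiplier_const)
    moreover have "1 / 2 * (?f j x + cnj (?f j x)) + 1 / 2 =
        complex_of_real (x j / ((x j)\<^sup>2 + 1) + 1 / 2)" for x
    proof -
      have "1 / 2 * (z + cnj z) = complex_of_real (Re z)" for z
        by (simp add: complex_eq_iff)
      then show ?thesis by (simp add: one_divide_complex_minus_i)
    qed
    ultimately show "(\<lambda>x. complex_of_real (x j / ((x j)\<^sup>2 + 1) + 1 / 2)) \<in> H"
      by (simp only:)
    have "(\<lambda>x. - \<i> / 2 * (?f j x - cnj (?f j x))) \<in> H"
      using f_mult[OF j] cnj_mult[OF j] by (intro multiplier_diff multiplier_mult multiplier_const)
    moreover have "- \<i> / 2 * (?f j x - cnj (?f j x)) = complex_of_real (1 / ((x j)\<^sup>2 + 1))" for x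
    proof -
      have "- \<i> / 2 * (z - cnj z) = complex_of_real (Im z)" for z
        by (simp add: complex_eq_iff)
      then show ?thesis by (simp add: one_divide_complex_minus_i)
    qed
    ultimately show "(\<lambda>x. complex_of_real (1 / ((x j)\<^sup>2 + 1))) \<in> H"
      by (simp only:)
    \<comment> \<open>The real part lies between -1/2 and 1/2, so its shift lies in the unit
      interval.\<close>
    have "\<bar>y / (y\<^sup>2 + 1)\<bar> \<le> 1 / 2" for y :: real
    proof -
      have "0 \<le> (\<bar>y\<bar> - 1)\<^sup>2" by simp
      then have "2 * \<bar>y\<bar> \<le> y\<^sup>2 + 1" by (simp add: power2_diff)
      then show ?thesis using pos[of y] by (simp add: abs_divide divide_le_eq)
    qed
    then show "x j / ((x j)\<^sup>2 + 1) + 1 / 2 \<in> {0..1}" for x :: "'i \<Rightarrow> real"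
      unfolding atLeastAtMost_iff by (smt (verit) field_sum_of_halves)
    show "1 / ((x j)\<^sup>2 + 1) \<in> {0..1}" for x :: "'i \<Rightarrow> real"
      using pos[of "x j"] by (simp add: divide_le_eq)
    show "(\<lambda>x. x j / ((x j)\<^sup>2 + 1) + 1 / 2) \<in> borel_measurable \<nu>"
      "(\<lambda>x. 1 / ((x j)\<^sup>2 + 1)) \<in> borel_measurable \<nu>"
      using xm[OF j] by measurable
  qed
  have "sets \<nu> \<subseteq> multiplier_sets"
    unfolding sets
    by (rule sets_vimage_constructible_borel_subset[OF
          sigma_algebra_multiplier_sets[unfolded space] coord[unfolded space]])
  note closure = closure_eq_Ls[OF this]
  show "dense_in_Ls (cpoly_fun ` polys \<Omega>) t \<nu>"
    unfolding dense_in_Ls_def F_def[symmetric]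
  proof (intro conjI ballI allI impI subsetI)
    show "f \<in> Ls_space t \<nu>" if "f \<in> F" for f
      using that F_measurable F_moments t_pos unfolding Ls_space_def Ls_norm_finite_iff by blast
    fix f and \<epsilon> :: ennreal assume f: "f \<in> Ls_space t \<nu>" and "0 < \<epsilon>"
    \<comment> \<open>For infinite \<epsilon> the value 1 serves.\<close>
    then obtain e where e: "0 < e" "ennreal e \<le> \<epsilon>"
      by (cases \<epsilon>) (auto intro: that[of 1])
    have "f \<in> C"
      using f unfolding Ls_space_def Ls_norm_finite_iff by (intro closure) auto
    then obtain g where g: "g \<in> F" "Ls_int t \<nu> (\<lambda>x. f x - g x) < ennreal (e powr t)"
      using closure_approx[of f "e powr t"] e(1) by auto
    have "Ls_norm t \<nu> (\<lambda>x. g x - f x) < ennreal e"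
      using g(2) unfolding Ls_norm_less_iff[OF t_pos e(1)] by (subst Ls_int_minus_commute)
    with e(2) g(1) show "\<exists>g\<in>F. Ls_norm t \<nu> (\<lambda>x. g x - f x) < \<epsilon>"
      by (blast intro: less_le_trans)
  qed
qed

end
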